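(* Let $\mathcal{A}:\mathcal{B}(\mathcal{H}_{\rm c})\to\mathcal{B}(\mathcal{H}_{\rm o})$ be a memoryless quantum channel (a trace-preserving completely positive map between finite-dimensional Hilbert spaces, used as $\mathcal{A}^{\otimes n}$ on $n$ copies). For every rate $R<Q(\mathcal{A})$ there exists an attainable exponent $E>0$ for $\mathcal{A}$ and $R$.
   Context: Fix a base $d$ (a prime; logarithms are taken to base $d$). A code for $\mathcal{A}^{\otimes n}$ is a triple $(\mathcal{K}_n,\mathcal{E}_n,\mathcal{D}_n)$ with $\mathcal{K}_n$ a finite-dimensional Hilbert space and $\mathcal{E}_n:\mathcal{B}(\mathcal{K}_n)\to\mathcal{B}(\mathcal{H}_{\rm c}^{\otimes n})$, $\mathcal{D}_n:\mathcal{B}(\mathcal{H}_{\rm o}^{\otimes n})\to\mathcal{B}(\mathcal{K}_n)$ trace-preserving completely positive maps. For a subspace/space $\mathcal{K}$, $\pi_{\mathcal{K}}$ is the projection onto $\mathcal{K}$ divided by $\dim\mathcal{K}$, and the entanglement fidelity is $F_{\rm e}(\rho,\mathcal{B})=\sum_j|\mathrm{tr}(\rho B_j)|^2$ for a completely positive map $\mathcal{B}$ with Kraus operators $B_j$. A number $R$ is an achievable rate for $\mathcal{A}$ if there is a sequence of codes with $\limsup_{n\to\infty}\frac{1}{n}\log_d\dim\mathcal{K}_n\ge R$ and $\lim_{n\to\infty}F_{\rm e}(\pi_{\mathcal{K}_n},\mathcal{D}_n\mathcal{A}^{\otimes n}\mathcal{E}_n)=1$ (composition of maps). The quantum capacity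 $Q(\mathcal{A})$ is the supremum of achievable rates. A number $E$ is an attainable exponent for $\mathcal{A}$ and rate $R$ if there is a sequence of codes with $\liminf_{n\to\infty}\frac{1}{n}\log_d\dim\mathcal{K}_n\ge R$ and $\liminf_{n\to\infty}-\frac{1}{n}\log_d\big[1-F_{\rm e}(\pi_{\mathcal{K}_n},\mathcal{D}_n\mathcal{A}^{\otimes n}\mathcal{E}_n)\big]\ge E$. *)

theory Defs
  imports "Jordan_Normal_Form.Matrix" "HOL-Library.Liminf_Limsup" "HOL-Library.Extended_Real"
begin

text \<open>Operators on C^m are complex matrices. A completely positive map
B(C^a) -> B(C^b) is represented by a (finite) list of Kraus operators, each a
b x a matrix; the map is rho |-> sum_j K_j rho K_j^dagger.\<close>

definition cadj :: "complex mat \<Rightarrow> complex mat" where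
  "cadj A = mat (dim_col A) (dim_row A) (\<lambda>(i,j). cnj (A $$ (j,i)))"

definition mtrace :: "complex mat \<Rightarrow> complex" where
  "mtrace A = (\<Sum>i<dim_row A. A $$ (i,i))"

definition kron :: "complex mat \<Rightarrow> complex mat \<Rightarrow> complex mat" where
  "kron A B = mat (dim_row A * dim_row B) (dim_col A * dim_col B)
     (\<lambda>(i,j). A $$ (i div dim_row B, j div dim_col B) * B $$ (i mod dim_row B, j mod dim_col B))"

definition is_channel :: "nat \<Rightarrow> nat \<Rightarrow> complex mat list \<Rightarrow> bool" where
  "is_channel a b Ks \<longleftrightarrow> (\<forall>K\<in>set Ks. K \<in> carrier_mat b a) \<and>
     foldr (+) (map (\<lambda>K. cadj K * K) Ks) (0\<^sub>m a a) = 1\<^sub>m a"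

fun kraus_tpow :: "complex mat list \<Rightarrow> nat \<Rightarrow> complex mat list" where
  "kraus_tpow Ks 0 = [1\<^sub>m 1]"
| "kraus_tpow Ks (Suc n) = [kron A B. A \<leftarrow> Ks, B \<leftarrow> kraus_tpow Ks n]"

definition kraus_comp3 :: "complex mat list \<Rightarrow> complex mat list \<Rightarrow> complex mat list \<Rightarrow> complex mat list" where
  "kraus_comp3 Ds As Es = [D * A * E. D \<leftarrow> Ds, A \<leftarrow> As, E \<leftarrow> Es]"

definition ent_fid_maxmixed :: "nat \<Rightarrow> complex mat list \<Rightarrow> real" where
  "ent_fid_maxmixed k Bs =
     (\<Sum>B\<leftarrow>Bs. (cmod (mtrace ((1 / of_nat k) \<cdot>\<^sub>m 1\<^sub>m k * B)))\<^sup>2)"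

definition is_code :: "nat \<Rightarrow> nat \<Rightarrow> nat \<Rightarrow> nat \<Rightarrow> complex mat list \<Rightarrow> complex mat list \<Rightarrow> bool" where
  "is_code dc dout n k Es Ds \<longleftrightarrow> k \<ge> 1 \<and> is_channel k (dc ^ n) Es \<and> is_channel (dout ^ n) k Ds"

definition code_fid :: "complex mat list \<Rightarrow> nat \<Rightarrow> nat \<Rightarrow> complex mat list \<Rightarrow> complex mat list \<Rightarrow> real" where
  "code_fid As n k Es Ds = ent_fid_maxmixed k (kraus_comp3 Ds (kraus_tpow As n) Es)"

definition achievable_rate ::
  "nat \<Rightarrow> nat \<Rightarrow> nat \<Rightarrow> complex mat list \<Rightarrow> real \<Rightarrow> bool" where
  "achievable_rate d dc dout As R \<longleftrightarrow>
     (\<exists>k Es Ds. (\<forall>n. is_code dc dout n (k n) (Es n) (Ds n)) \<and>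
        limsup (\<lambda>n. ereal (log (real d) (real (k n)) / real n)) \<ge> ereal R \<and>
        (\<lambda>n. code_fid As n (k n) (Es n) (Ds n)) \<longlonglongrightarrow> 1)"

definition quantum_capacity :: "nat \<Rightarrow> nat \<Rightarrow> nat \<Rightarrow> complex mat list \<Rightarrow> ereal" where
  "quantum_capacity d dc dout As = Sup {ereal R | R. achievable_rate d dc dout As R}"

text \<open>-(1/n) log_d (1 - F), with the convention -log 0 = +infinity.\<close>
definition err_exp_term :: "nat \<Rightarrow> nat \<Rightarrow> real \<Rightarrow> ereal" where
  "err_exp_term d n F = (if 1 - F \<le> 0 then \<infinity> else ereal (- log (real d) (1 - F) / real n))"

definition attainable_exponent ::
  "nat \<Rightarrow> nat \<Rightarrow> nat \<Rightarrow> complex mat list \<Rightarrow> real \<Rightarrow> real \<Rightarrow> bool" where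
  "attainable_exponent d dc dout As R E \<longleftrightarrow>
     (\<exists>k Es Ds. (\<forall>n. is_code dc dout n (k n) (Es n) (Ds n)) \<and>
        liminf (\<lambda>n. ereal (log (real d) (real (k n)) / real n)) \<ge> ereal R \<and>
        liminf (\<lambda>n. err_exp_term d n (code_fid As n (k n) (Es n) (Ds n))) \<ge> ereal E)"

end

theory Submission
  imports Defs "HOL-Computational_Algebra.Primes"
begin

text \<open>
  The proof is by concatenation. An achievable rate \<open>R' > R\<close> supplies, for suitable large \<open>n\<close>, an inner
  code of dimension at least \<open>q = 2^l\<close> whose infidelity is as small as we like; restricting it to a
  \<open>q\<close>-dimensional subspace at most doubles the infidelity. The \<open>m\<close>-fold power of the resulting
  effective channel on \<open>C^q\<close> is protected by an outer code on \<open>N = m l\<close> qubits correcting all Pauli errors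
  that touch at most \<open>t = m div s\<close> of the \<open>m\<close> blocks.

  The outer code is a CSS-like code. Its basis vectors are uniform superpositions over cosets
  of an XOR-subgroup \<open>C\<close> on which no phase error of weight at most \<open>2t\<close> acts trivially; \<open>C\<close> is built greedily,
  and the cosets are chosen greedily far apart.

  Conjugating code and decoder by a random Pauli operator turns the effective channel into the Pauli channel with
  the same diagonal Pauli coefficients, for which the probability of more than \<open>t\<close> bad blocks is a
  binomial tail; hence some conjugate of the code has exponentially small infidelity.
\<close>

section \<open>Kraus lists and tensor powers\<close>

text \<open>Two gaps separate hypothesis and goal. Achievability gives good rates only at infinitely
  many lengths and says nothing about how fast the infidelity vanishes; an exponent needs good codes
  at every large length. A single inner code closes both: its length \<open>n\<close> stays fixed,
  the decay comes only from the number \<open>m\<close> of blocks, and lengths that are not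
  multiples of \<open>n\<close> are padded with idle channel uses, which do not change the fidelity.

  A power of a channel close to the identity is not a mixture of errors on few blocks, since
  amplitudes of different errors can interfere. Twirling removes the interference. The squared
  identity coefficient, summed over the Kraus operators, is exactly the entanglement fidelity, so an
  inner infidelity of at most \<epsilon> becomes a block error probability of at most \<epsilon>,
  independent across blocks.

  The inner dimension is a power of 2 whatever \<open>d\<close> is, so that bit strings under
  \<open>xor\<close> label the errors. The outer code only needs to correct a small constant
  fraction of blocks at a rate near 1, so crude greedy counting suffices.\<close>

lemma sum_list_concat_map:
  "(\<Sum>z\<leftarrow>concat (map g xs). f z) = (\<Sum>x\<leftarrow>xs. \<Sum>z\<leftarrow>g x. f z)"
  by (induction xs) auto

lemma sum_list_sum_swap:
  "(\<Sum>x\<leftarrow>xs. \<Sum>i\<in>A. f x i) = (\<Sum>i\<in>A. \<Sum>x\<leftarrow>xs. f x (i::'i) :: 'a::comm_monoid_add)"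
  by (induction xs) (auto simp: sum.distrib)

lemma sum_list_swap:
  "(\<Sum>x\<leftarrow>xs. \<Sum>y\<leftarrow>ys. f x y) = (\<Sum>y\<leftarrow>ys. \<Sum>x\<leftarrow>xs. f x y :: 'a::comm_monoid_add)"
  by (induction xs) (auto simp: sum_list_addf)

lemma sum_list_mult_pull:
  fixes c :: "'a::semiring_0"
  shows "(\<Sum>x\<leftarrow>xs. c * f x) = c * (\<Sum>x\<leftarrow>xs. f x)" "(\<Sum>x\<leftarrow>xs. f x * c) = (\<Sum>x\<leftarrow>xs. f x) * c"
  by (induction xs) (auto simp: algebra_simps)

lemma sum_lessThan_mult:
  "(\<Sum>x<a*b. f x) = (\<Sum>i<a. \<Sum>j<b. f (i*b+j::nat) :: 'a::comm_monoid_add)"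
proof -
  have "(\<Sum>x<a*b. f x) = (\<Sum>i<a. \<Sum>x\<in>{i*b..<i*b+b}. f x)"
    by (simp add: sum.nat_group)
  also have "\<dots> = (\<Sum>i<a. \<Sum>j<b. f (i*b+j))"
    by (rule sum.cong[OF refl], subst sum.atLeastLessThan_shift_0) (simp add: lessThan_atLeast0)
  finally show ?thesis .
qed

lemma mult_index:
  assumes "A \<in> carrier_mat a b" "B \<in> carrier_mat b c" "i < a" "j < c"
  shows "(A * B) $$ (i,j) = (\<Sum>s<b. A $$ (i,s) * B $$ (s,j))"
  using assms by (auto simp: scalar_prod_def lessThan_atLeast0)

lemma cadj_carrier [simp, intro]: "A \<in> carrier_mat a b \<Longrightarrow> cadj A \<in> carrier_mat b a"
  by (auto simp: cadj_def)

lemma cadj_index: "A \<in> carrier_mat a b \<Longrightarrow> i < b \<Longrightarrow> j < a \<Longrightarrow> cadj A $$ (i,j) = cnj (A $$ (j,i))"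
  by (auto simp: cadj_def)

lemma kron_carrier [intro]:
  "A \<in> carrier_mat a b \<Longrightarrow> B \<in> carrier_mat a' b' \<Longrightarrow> kron A B \<in> carrier_mat (a*a') (b*b')"
  by (auto simp: kron_def)

lemma mult_add_less:
  fixes i a j b :: nat assumes "i < a" "j < b" shows "i*b+j < a*b"
proof -
  have "i*b+j < Suc i * b" using assms by simp
  also have "\<dots> \<le> a*b" using assms by (intro mult_le_mono1) simp
  finally show ?thesis .
qed

lemma kron_index:
  assumes "A \<in> carrier_mat a b" "B \<in> carrier_mat a' b'" "i < a" "i' < a'" "j < b" "j' < b'"
  shows "kron A B $$ (i*a'+i', j*b'+j') = A $$ (i,j) * B $$ (i',j')"
  using assms mult_add_less[of i a i' a'] mult_add_less[of j b j' b'] by (auto simp: kron_def)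

lemma kron_index':
  assumes "A \<in> carrier_mat a b" "B \<in> carrier_mat a' b'" "i < a*a'" "j < b*b'"
  shows "kron A B $$ (i, j) = A $$ (i div a',j div b') * B $$ (i mod a',j mod b')"
  using assms by (auto simp: kron_def)

lemma kron_mult:
  assumes A: "A \<in> carrier_mat a b" and C: "C \<in> carrier_mat b c"
    and B: "B \<in> carrier_mat a' b'" and D: "D \<in> carrier_mat b' c'"
  shows "kron A B * kron C D = kron (A * C) (B * D)"
proof (rule eq_matI)
  note AB = kron_carrier[OF A B] and CD = kron_carrier[OF C D]
  note AC = mult_carrier_mat[OF A C] and BD = mult_carrier_mat[OF B D]
  note k = kron_carrier[OF AC BD]
  show "dim_row (kron A B * kron C D) = dim_row (kron (A * C) (B * D))"
    "dim_col (kron A B * kron C D) = dim_col (kron (A * C) (B * D))"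
    using AB CD k by auto
  fix i j assume "i < dim_row (kron (A * C) (B * D))" "j < dim_col (kron (A * C) (B * D))"
  then have i: "i < a*a'" and j: "j < c*c'" using k by auto
  then have a0: "i div a' < a" "i mod a' < a'" "j div c' < c" "j mod c' < c'"
    by (auto simp: less_mult_imp_div_less intro!: mod_less_divisor gr0I)
  have "(kron A B * kron C D) $$ (i,j) = (\<Sum>s<b*b'. kron A B $$ (i,s) * kron C D $$ (s,j))"
    by (rule mult_index[OF AB CD i j])
  also have "\<dots> = (\<Sum>s<b. \<Sum>s'<b'. kron A B $$ (i,s*b'+s') * kron C D $$ (s*b'+s',j))"
    by (rule sum_lessThan_mult)
  also have "\<dots> = (\<Sum>s<b. \<Sum>s'<b'. (A $$ (i div a',s) * C $$ (s,j div c')) * (B $$ (i mod a',s') * D $$ (s',j mod c')))"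
    using i j by (intro sum.cong refl) (auto simp: kron_index'[OF A B] kron_index'[OF C D] mult_add_less)
  also have "\<dots> = (A*C) $$ (i div a', j div c') * (B*D) $$ (i mod a', j mod c')"
    unfolding mult_index[OF A C a0(1,3)] mult_index[OF B D a0(2,4)] by (rule sum_product[symmetric])
  also have "\<dots> = kron (A*C) (B*D) $$ (i,j)"
    using kron_index'[OF AC BD i j] by simp
  finally show "(kron A B * kron C D) $$ (i,j) = kron (A*C) (B*D) $$ (i,j)" .
qed

lemma div_mod_mult_assoc:
  fixes x a b c :: nat
  assumes "x < a*(b*c)"
  shows "x div c < a*b" "x mod c < c" "x div (b*c) < a" "x mod (b*c) < b*c" "x div c div b = x div (b*c)"
    "x div c mod b = x mod (b*c) div c" "x mod (b*c) mod c = x mod c"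
proof -
  have pos: "b > 0" "c > 0" using assms by (auto intro!: gr0I)
  have 1: "x mod (c*b) = c * (x div c mod b) + x mod c"
    by (rule mod_mult2_eq)
  show "x div c < a*b" using assms by (intro less_mult_imp_div_less) (simp add: mult.assoc)
  show "x mod c < c" "x mod (b*c) < b*c" using pos by auto
  show "x div (b*c) < a" using assms by (intro less_mult_imp_div_less)
  show "x div c div b = x div (b*c)" by (simp add: div_mult2_eq[symmetric] mult.commute)
  show "x div c mod b = x mod (b*c) div c" "x mod (b*c) mod c = x mod c"
    using 1 pos by (auto simp: mult.commute)
qed

lemma kron_assoc: "kron (kron A B) C = kron A (kron B C)"
proof (rule eq_matI)
  fix i j assume "i < dim_row (kron A (kron B C))" "j < dim_col (kron A (kron B C))"
  then have "i < dim_row A * (dim_row B * dim_row C)" "j < dim_col A * (dim_col B * dim_col C)"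
    by (auto simp: kron_def)
  then show "kron (kron A B) C $$ (i,j) = kron A (kron B C) $$ (i,j)"
    by (auto simp: kron_def div_mod_mult_assoc mult.assoc)
qed (auto simp: kron_def)


section \<open>Entrywise completeness relation; closure of channels under composition and tensor
  products\<close>

lemma foldr_add_mat:
  assumes "\<And>K. K \<in> set Ks \<Longrightarrow> f K \<in> carrier_mat a b"
  shows "foldr (+) (map f Ks) (0\<^sub>m a b) \<in> carrier_mat a b"
    and "i < a \<Longrightarrow> j < b \<Longrightarrow> foldr (+) (map f Ks) (0\<^sub>m a b) $$ (i,j) = (\<Sum>K\<leftarrow>Ks. f K $$ (i,j))"
  using assms
proof (induction Ks)
  case (Cons K Ks)
  {
    case 1
    show ?case using Cons.IH(1) 1 by auto
  next
    case 2
    have "foldr (+) (map f Ks) (0\<^sub>m a b) \<in> carrier_mat a b" using Cons.IH(1) 2 by auto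
    then show ?case using Cons.IH(2) 2 by auto
  }
qed auto

text \<open>Entry (i,j) of the sum of K^dagger K, written out. Later proofs that a list is a channel
  go through this form, which replaces matrix algebra under a \<open>foldr\<close> by an identity
  between finite complex sums.\<close>

lemma is_channel_iff:
  "is_channel a b Ks \<longleftrightarrow> (\<forall>K\<in>set Ks. K \<in> carrier_mat b a) \<and>
    (\<forall>i<a. \<forall>j<a. (\<Sum>K\<leftarrow>Ks. \<Sum>r<b. cnj (K $$ (r,i)) * K $$ (r,j)) = (if i = j then 1 else 0))"
proof (cases "\<forall>K\<in>set Ks. K \<in> carrier_mat b a")
  case True
  let ?S = "foldr (+) (map (\<lambda>K. cadj K * K) Ks) (0\<^sub>m a a)"
  have c: "\<And>K. K \<in> set Ks \<Longrightarrow> cadj K * K \<in> carrier_mat a a" using True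
    by (auto intro!: mult_carrier_mat)
  have S: "?S \<in> carrier_mat a a" using foldr_add_mat(1)[of Ks "\<lambda>K. cadj K * K" a a, OF c] .
  have e: "?S $$ (i,j) = (\<Sum>K\<leftarrow>Ks. \<Sum>r<b. cnj (K $$ (r,i)) * K $$ (r,j))" if "i < a" "j < a" for i j
    using True that
    by (subst foldr_add_mat(2)[where a=a and b=a, OF c]) (simp_all, intro arg_cong[where f=sum_list] map_cong refl,
       auto simp: mult_index[OF cadj_carrier, of _ b a _ a] cadj_index[of _ b a] intro!: sum.cong)
  have "?S = 1\<^sub>m a \<longleftrightarrow> (\<forall>i<a. \<forall>j<a. ?S $$ (i,j) = (if i = j then 1 else 0))"
    using S by (auto simp: mat_eq_iff)
  then show ?thesis using True e by (simp add: is_channel_def)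
qed (auto simp: is_channel_def)

lemma is_channelD:
  assumes "is_channel a b Ks"
  shows "K \<in> set Ks \<Longrightarrow> K \<in> carrier_mat b a"
    and "i < a \<Longrightarrow> j < a \<Longrightarrow>
      (\<Sum>K\<leftarrow>Ks. \<Sum>r<b. cnj (K $$ (r,i)) * K $$ (r,j)) = (if i = j then 1 else 0)"
  using assms by (auto simp: is_channel_iff)

lemma is_channel_compose:
  assumes K: "is_channel b c Ks" and L: "is_channel a b Ls"
  shows "is_channel a c [K * L. K \<leftarrow> Ks, L \<leftarrow> Ls]"
  unfolding is_channel_iff
proof (intro conjI ballI allI impI)
  fix X assume "X \<in> set [K * L. K \<leftarrow> Ks, L \<leftarrow> Ls]"
  then show "X \<in> carrier_mat c a" using is_channelD(1)[OF K] is_channelD(1)[OF L]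
    by (auto intro!: mult_carrier_mat)
next
  fix i j assume i: "i < a" and j: "j < a"
  let ?g = "\<lambda>X. \<Sum>r<c. cnj (X $$ (r,i)) * X $$ (r,j)"
  have 1: "(\<Sum>K\<leftarrow>Ks. ?g (K * L)) = (\<Sum>s<b. cnj (L $$ (s,i)) * L $$ (s,j))" if l: "L \<in> set Ls" for L
  proof -
    note Lc = is_channelD(1)[OF L l]
    have "(\<Sum>K\<leftarrow>Ks. ?g (K * L)) = (\<Sum>K\<leftarrow>Ks. \<Sum>r<c. \<Sum>s<b. \<Sum>t<b. cnj (L $$ (s,i)) * L $$ (t,j) * (cnj (K $$ (r,s)) * K $$ (r,t)))"
      using is_channelD(1)[OF K] i j
      by (intro arg_cong[where f=sum_list] map_cong refl sum.cong)
         (simp add: mult_index[OF is_channelD(1)[OF K] Lc] sum_product, simp add: ac_simps)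
    also have "\<dots> = (\<Sum>s<b. \<Sum>t<b. \<Sum>K\<leftarrow>Ks. \<Sum>r<c. cnj (L $$ (s,i)) * L $$ (t,j) * (cnj (K $$ (r,s)) * K $$ (r,t)))"
      by (simp only: sum_list_sum_swap[symmetric] sum.swap[where A="{..<c}" and B="{..<b}"])
    also have "\<dots> = (\<Sum>s<b. \<Sum>t<b. cnj (L $$ (s,i)) * L $$ (t,j) * (\<Sum>K\<leftarrow>Ks. \<Sum>r<c. cnj (K $$ (r,s)) * K $$ (r,t)))"
      by (simp add: sum_distrib_left sum_list_mult_pull[symmetric])
    also have "\<dots> = (\<Sum>s<b. \<Sum>t<b. if t = s then cnj (L $$ (s,i)) * L $$ (t,j) else 0)"
      by (intro sum.cong refl) (auto simp: is_channelD(2)[OF K])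
    finally show ?thesis by simp
  qed
  have "(\<Sum>X\<leftarrow>[K * L. K \<leftarrow> Ks, L \<leftarrow> Ls]. ?g X) = (\<Sum>L\<leftarrow>Ls. \<Sum>K\<leftarrow>Ks. ?g (K * L))"
    by (simp add: sum_list_concat_map o_def) (rule sum_list_swap)
  also have "\<dots> = (\<Sum>L\<leftarrow>Ls. \<Sum>s<b. cnj (L $$ (s,i)) * L $$ (s,j))"
    using 1 by (intro arg_cong[where f=sum_list] map_cong refl)
  also have "\<dots> = (if i = j then 1 else 0)" by (rule is_channelD(2)[OF L i j])
  finally show "(\<Sum>X\<leftarrow>[K * L. K \<leftarrow> Ks, L \<leftarrow> Ls]. ?g X) = (if i = j then 1 else 0)" .
qed

lemma is_channel_kron:
  assumes K: "is_channel a b Ks" and L: "is_channel a' b' Ls"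
  shows "is_channel (a*a') (b*b') [kron K L. K \<leftarrow> Ks, L \<leftarrow> Ls]"
  unfolding is_channel_iff
proof (intro conjI ballI allI impI)
  fix X assume "X \<in> set [kron K L. K \<leftarrow> Ks, L \<leftarrow> Ls]"
  then show "X \<in> carrier_mat (b*b') (a*a')" using is_channelD(1)[OF K] is_channelD(1)[OF L] by auto
next
  fix i j assume i: "i < a*a'" and j: "j < a*a'"
  let ?g = "\<lambda>X. \<Sum>r<b*b'. cnj (X $$ (r,i)) * X $$ (r,j)"
  have d: "i div a' < a" "i mod a' < a'" "j div a' < a" "j mod a' < a'"
    using i j by (auto simp: less_mult_imp_div_less intro!: mod_less_divisor gr0I)
  have "(\<Sum>X\<leftarrow>[kron K L. K \<leftarrow> Ks, L \<leftarrow> Ls]. ?g X) = (\<Sum>K\<leftarrow>Ks. \<Sum>L\<leftarrow>Ls. ?g (kron K L))"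
    by (simp add: sum_list_concat_map o_def)
  also have "\<dots> = (\<Sum>K\<leftarrow>Ks. \<Sum>L\<leftarrow>Ls. (\<Sum>r<b. cnj (K $$ (r,i div a')) * K $$ (r,j div a')) *
      (\<Sum>r<b'. cnj (L $$ (r,i mod a')) * L $$ (r,j mod a')))"
  proof (intro arg_cong[where f=sum_list] map_cong refl)
    fix X Y assume "X \<in> set Ks" "Y \<in> set Ls"
    then have "X \<in> carrier_mat b a" "Y \<in> carrier_mat b' a'" using is_channelD(1)[OF K] is_channelD(1)[OF L] by auto
    then show "?g (kron X Y) = (\<Sum>r<b. cnj (X $$ (r,i div a')) * X $$ (r,j div a')) *
      (\<Sum>r<b'. cnj (Y $$ (r,i mod a')) * Y $$ (r,j mod a'))"
      unfolding sum_lessThan_mult sum_product using i j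
      by (intro sum.cong refl) (auto simp: kron_index'[of _ b a _ b' a'] mult_add_less)
  qed
  also have "\<dots> = (if i div a' = j div a' then 1 else 0) * (if i mod a' = j mod a' then 1 else 0)"
    by (simp add: sum_list_mult_pull is_channelD(2)[OF K] is_channelD(2)[OF L] d)
  also have "\<dots> = (if i = j then 1 else 0)"
    by (auto, metis div_mult_mod_eq)
  finally show "(\<Sum>X\<leftarrow>[kron K L. K \<leftarrow> Ks, L \<leftarrow> Ls]. ?g X) = (if i = j then 1 else 0)" .
qed

lemma is_channel_one: "is_channel a a [1\<^sub>m a]"
  by (auto simp: is_channel_iff if_distrib[of cnj] if_distrib[of "\<lambda>x. _ * x"] cong: if_cong)

lemma is_channel_tpow: "is_channel a b Ks \<Longrightarrow> is_channel (a^n) (b^n) (kraus_tpow Ks n)"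
  by (induction n) (auto intro: is_channel_one is_channel_kron)

lemma tpow_carrier:
  "(\<And>K. K \<in> set Ks \<Longrightarrow> K \<in> carrier_mat b a) \<Longrightarrow> X \<in> set (kraus_tpow Ks n) \<Longrightarrow> X \<in> carrier_mat (b^n) (a^n)"
  by (induction n arbitrary: X) auto

lemma kron_one_left: "kron (1\<^sub>m (Suc 0)) A = A"
  by (rule eq_matI) (auto simp: kron_def less_mult_imp_div_less)

text \<open>An equality of lists, order included: both sides enumerate the factors
  lexicographically, and \<open>kron\<close> is associative on the nose, so no isomorphism of tensor
  products has to be carried along.\<close>

lemma kraus_tpow_add: "kraus_tpow Ks (m + n) = [kron A B. A \<leftarrow> kraus_tpow Ks m, B \<leftarrow> kraus_tpow Ks n]"
proof (induction m)
  case 0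
  have "map (kron (1\<^sub>m (Suc 0))) Xs = Xs" for Xs by (induction Xs) (auto simp: kron_one_left)
  then show ?case by simp
next
  case (Suc m)
  have *: "concat (map (\<lambda>A. map (kron A) (concat (map (\<lambda>B. map (kron B) Y) X))) Z)
    = concat (map (\<lambda>A. map (kron A) Y) (concat (map (\<lambda>A. map (kron A) X) Z)))" for X Y Z
  proof -
    have "kron (kron A B) = (\<lambda>C. kron A (kron B C))" for A B by (simp add: fun_eq_iff kron_assoc)
    then show ?thesis by (induction Z) (auto simp: map_concat o_def)
  qed
  show ?case using Suc * by simp
qed

lemma kraus_tpow_mult: "kraus_tpow (kraus_tpow Ks n) m = kraus_tpow Ks (n * m)"
  by (induction m) (auto simp: kraus_tpow_add)

text \<open>The mixed-product rule \<open>kron_mult\<close> matches the operators on both sides, but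
  the two lists enumerate them in different orders. Fidelities only need sums, so the claim is about
  an arbitrary \<open>f\<close>; this also lets the induction absorb the leading Kronecker factor
  into \<open>f\<close>.\<close>

lemma sum_tpow_comp3:
  fixes f :: "complex mat \<Rightarrow> 'a::comm_monoid_add"
  assumes D: "\<And>X. X \<in> set Ds \<Longrightarrow> X \<in> carrier_mat a b" and A: "\<And>X. X \<in> set As \<Longrightarrow> X \<in> carrier_mat b c"
    and E: "\<And>X. X \<in> set Es \<Longrightarrow> X \<in> carrier_mat c e"
  shows "(\<Sum>T\<leftarrow>kraus_tpow (kraus_comp3 Ds As Es) m. f T) =
    (\<Sum>D\<leftarrow>kraus_tpow Ds m. \<Sum>A\<leftarrow>kraus_tpow As m. \<Sum>E\<leftarrow>kraus_tpow Es m. f (D * A * E))"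
proof (induction m arbitrary: f)
  case 0
  show ?case by simp
next
  case (Suc m)
  have "(\<Sum>T\<leftarrow>kraus_tpow (kraus_comp3 Ds As Es) (Suc m). f T) =
    (\<Sum>D\<leftarrow>Ds. \<Sum>A\<leftarrow>As. \<Sum>E\<leftarrow>Es. \<Sum>T\<leftarrow>kraus_tpow (kraus_comp3 Ds As Es) m. f (kron (D * A * E) T))"
    by (simp add: kraus_comp3_def sum_list_concat_map o_def)
  also have "\<dots> = (\<Sum>D\<leftarrow>Ds. \<Sum>A\<leftarrow>As. \<Sum>E\<leftarrow>Es.
     \<Sum>D'\<leftarrow>kraus_tpow Ds m. \<Sum>A'\<leftarrow>kraus_tpow As m. \<Sum>E'\<leftarrow>kraus_tpow Es m. f (kron (D * A * E) (D' * A' * E')))"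
    by (simp add: Suc)
  also have "\<dots> = (\<Sum>D\<leftarrow>Ds. \<Sum>A\<leftarrow>As. \<Sum>E\<leftarrow>Es.
     \<Sum>D'\<leftarrow>kraus_tpow Ds m. \<Sum>A'\<leftarrow>kraus_tpow As m. \<Sum>E'\<leftarrow>kraus_tpow Es m. f (kron D D' * kron A A' * kron E E'))"
  proof (intro arg_cong[where f=sum_list] map_cong refl)
    fix X Y Z X' Y' Z' assume "X \<in> set Ds" "Y \<in> set As" "Z \<in> set Es"
      "X' \<in> set (kraus_tpow Ds m)" "Y' \<in> set (kraus_tpow As m)" "Z' \<in> set (kraus_tpow Es m)"
    note c = D[OF this(1)] A[OF this(2)] E[OF this(3)] tpow_carrier[of Ds, OF D this(4)] tpow_carrier[of As, OF A this(5)] tpow_carrier[of Es, OF E this(6)]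
    show "f (kron (X * Y * Z) (X' * Y' * Z')) = f (kron X X' * kron Y Y' * kron Z Z')"
      using c by (simp add: kron_mult[of _ a b _ c _ "a^m" "b^m" _ "c^m"] kron_mult[of _ a c _ e _ "a^m" "c^m" _ "e^m"])
  qed
  also have "\<dots> = (\<Sum>D\<leftarrow>Ds. \<Sum>D'\<leftarrow>kraus_tpow Ds m. \<Sum>A\<leftarrow>As. \<Sum>A'\<leftarrow>kraus_tpow As m. \<Sum>E\<leftarrow>Es. \<Sum>E'\<leftarrow>kraus_tpow Es m. f (kron D D' * kron A A' * kron E E'))"
    by (simp only: sum_list_swap[where xs=Es and ys="kraus_tpow Ds m"]
      sum_list_swap[where xs=As and ys="kraus_tpow Ds m"] sum_list_swap[where xs=Es and ys="kraus_tpow As m"])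
  also have "\<dots> = (\<Sum>D\<leftarrow>kraus_tpow Ds (Suc m). \<Sum>A\<leftarrow>kraus_tpow As (Suc m). \<Sum>E\<leftarrow>kraus_tpow Es (Suc m). f (D * A * E))"
    by (simp add: sum_list_concat_map o_def)
  finally show ?case .
qed

section \<open>Entanglement fidelity, padding and restriction of codes\<close>

lemma of_real_sum_list: "of_real (\<Sum>x\<leftarrow>xs. f x) = (\<Sum>x\<leftarrow>xs. of_real (f x) :: complex)"
  by (induction xs) auto

lemma is_channel_norm:
  assumes "is_channel a b Ks" "i < a"
  shows "(\<Sum>K\<leftarrow>Ks. \<Sum>r<b. (cmod (K $$ (r,i)))\<^sup>2) = 1"
proof -
  have "complex_of_real (\<Sum>K\<leftarrow>Ks. \<Sum>r<b. (cmod (K $$ (r,i)))\<^sup>2) = (\<Sum>K\<leftarrow>Ks. \<Sum>r<b. cnj (K $$ (r,i)) * K $$ (r,i))"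
    by (simp only: of_real_sum_list of_real_sum complex_norm_square mult.commute)
  also have "\<dots> = 1" using is_channelD(2)[OF assms(1) assms(2) assms(2)] by simp
  finally show ?thesis using of_real_eq_1_iff by blast
qed

lemma is_channel_comp3:
  assumes "is_channel c e Ds" "is_channel b c As" "is_channel a b Es"
  shows "is_channel a e (kraus_comp3 Ds As Es)"
proof -
  have "kraus_comp3 Ds As Es = [X * E. X \<leftarrow> [D * A. D \<leftarrow> Ds, A \<leftarrow> As], E \<leftarrow> Es]"
    by (simp add: kraus_comp3_def map_concat o_def) (induction Ds; simp add: map_concat o_def)
  then show ?thesis using is_channel_compose[OF is_channel_compose[OF assms(1,2)] assms(3)] by simp
qed

lemma mtrace_eq: "A \<in> carrier_mat k k \<Longrightarrow> mtrace A = (\<Sum>i<k. A $$ (i,i))"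
  by (simp add: mtrace_def)

lemma mtrace_kron:
  assumes "A \<in> carrier_mat a a" "B \<in> carrier_mat b b"
  shows "mtrace (kron A B) = mtrace A * mtrace B"
  using assms
  by (simp add: mtrace_eq[OF kron_carrier[OF assms]] mtrace_eq sum_lessThan_mult sum_product kron_index[OF assms])

lemma ent_fid_maxmixed_eq:
  assumes "\<And>B. B \<in> set Bs \<Longrightarrow> B \<in> carrier_mat k k"
  shows "ent_fid_maxmixed k Bs = (\<Sum>B\<leftarrow>Bs. (cmod (mtrace B))\<^sup>2) / (real k)\<^sup>2"
proof -
  have "(cmod (mtrace ((1 / of_nat k) \<cdot>\<^sub>m 1\<^sub>m k * B)))\<^sup>2 = (cmod (mtrace B))\<^sup>2 * (1 / (real k)\<^sup>2)" if "B \<in> set Bs" for B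
  proof -
    have B: "B \<in> carrier_mat k k" using assms that by auto
    then have "(1 / of_nat k) \<cdot>\<^sub>m 1\<^sub>m k * B = (1 / of_nat k) \<cdot>\<^sub>m B"
      by (simp add: mult_smult_assoc_mat[of _ k k _ k])
    then have "mtrace ((1 / of_nat k) \<cdot>\<^sub>m 1\<^sub>m k * B) = (1 / of_nat k) * mtrace B"
      using B by (simp add: mtrace_def sum_distrib_left)
    then show ?thesis by (simp add: norm_divide power_divide)
  qed
  then have "ent_fid_maxmixed k Bs = (\<Sum>B\<leftarrow>Bs. (cmod (mtrace B))\<^sup>2 * (1 / (real k)\<^sup>2))"
    unfolding ent_fid_maxmixed_def by (intro arg_cong[where f=sum_list] map_cong refl)
  then show ?thesis unfolding sum_list_mult_pull by simp
qed

lemma is_channel_code: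
  assumes "is_channel dc dout As" "is_code dc dout n k Es Ds"
  shows "is_channel k k (kraus_comp3 Ds (kraus_tpow As n) Es)"
  using assms by (auto simp: is_code_def intro!: is_channel_comp3 is_channel_tpow)

lemma code_fid_eq:
  assumes "is_channel dc dout As" "is_code dc dout n k Es Ds"
  shows "code_fid As n k Es Ds = (\<Sum>B\<leftarrow>kraus_comp3 Ds (kraus_tpow As n) Es. (cmod (mtrace B))\<^sup>2) / (real k)\<^sup>2"
  unfolding code_fid_def
  by (rule ent_fid_maxmixed_eq) (rule is_channelD(1)[OF is_channel_code[OF assms]])

lemma sum_comp3:
  "(\<Sum>B\<leftarrow>kraus_comp3 Ds As Es. f B) = (\<Sum>D\<leftarrow>Ds. \<Sum>A\<leftarrow>As. \<Sum>E\<leftarrow>Es. f (D * A * E))"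
  by (simp add: kraus_comp3_def sum_list_concat_map o_def)

section \<open>Idle channel uses: fixed input, discarded output\<close>

definition ket0 :: "nat \<Rightarrow> complex mat" where
  "ket0 a = mat a 1 (\<lambda>(r,c). if r = 0 then 1 else 0)"

definition bra :: "nat \<Rightarrow> nat \<Rightarrow> complex mat" where
  "bra a i = mat 1 a (\<lambda>(r,c). if c = i then 1 else 0)"

lemma is_channel_ket0: "a \<ge> 1 \<Longrightarrow> is_channel 1 a [ket0 a]"
  by (auto simp: is_channel_iff ket0_def if_distrib[of cnj] if_distrib[of "\<lambda>x. _ * x"] cong: if_cong)

text \<open>The trace map, which discards a system of dimension \<open>a\<close>.\<close>

lemma is_channel_bra: "is_channel a 1 (map (bra a) [0..<a])"
  unfolding is_channel_iff
proof (intro conjI ballI allI impI)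
  fix i j assume ij: "i < a" "j < a"
  have "(\<Sum>r<1. cnj (bra a s $$ (r, i)) * bra a s $$ (r, j)) = (if s = i then if i = j then 1 else 0 else 0)" for s
    using ij by (auto simp: bra_def)
  then show "(\<Sum>K\<leftarrow>map (bra a) [0..<a]. \<Sum>r<1. cnj (K $$ (r, i)) * K $$ (r, j)) = (if i = j then 1 else 0)"
    using ij by (simp add: interv_sum_list_conv_sum_set_nat o_def sum.delta)
qed (auto simp: bra_def)

text \<open>The additional use is fed the state of \<open>ket0\<close> and its output is traced out
  by the \<open>bra\<close> family. Every trace factors, and the additional factors sum to the
  squared norm of the first column over all of \<open>As\<close>, which is 1 by trace preservation.
  The idle factor stands on the left because \<open>kraus_tpow\<close> adds factors there.\<close>

lemma code_pad_Suc:
  assumes A: "is_channel dc dout As" and C: "is_code dc dout n k Es Ds" and dc: "dc \<ge> 1"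
  shows "\<exists>Es' Ds'. is_code dc dout (Suc n) k Es' Ds' \<and> code_fid As (Suc n) k Es' Ds' = code_fid As n k Es Ds"
proof -
  define Es' where "Es' = [kron K L. K \<leftarrow> [ket0 dc], L \<leftarrow> Es]"
  define Ds' where "Ds' = [kron K L. K \<leftarrow> map (bra dout) [0..<dout], L \<leftarrow> Ds]"
  have E: "is_channel k (dc^n) Es" and D: "is_channel (dout^n) k Ds" and k: "k \<ge> 1" using C by (auto simp: is_code_def)
  have C': "is_code dc dout (Suc n) k Es' Ds'"
    using is_channel_kron[OF is_channel_ket0[OF dc] E] is_channel_kron[OF is_channel_bra D] k
    by (simp add: is_code_def Es'_def Ds'_def)
  note T = is_channel_tpow[OF A, of n]
  have tr: "(cmod (mtrace (kron (bra dout i) Y * kron X Z * kron (ket0 dc) W)))\<^sup>2 = (cmod (X $$ (i,0)))\<^sup>2 * (cmod (mtrace (Y * Z * W)))\<^sup>2"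
    if "i \<in> set [0..<dout]" "Y \<in> set Ds" "X \<in> set As" "Z \<in> set (kraus_tpow As n)" "W \<in> set Es" for i Y X Z W
  proof -
    have c: "bra dout i \<in> carrier_mat 1 dout" "ket0 dc \<in> carrier_mat dc 1" "Y \<in> carrier_mat k (dout^n)"
      "X \<in> carrier_mat dout dc" "Z \<in> carrier_mat (dout^n) (dc^n)" "W \<in> carrier_mat (dc^n) k" "i < dout"
      using that is_channelD(1)[OF A] is_channelD(1)[OF D] is_channelD(1)[OF E] is_channelD(1)[OF T] by (auto simp: bra_def ket0_def)
    have 1: "bra dout i * X * ket0 dc \<in> carrier_mat 1 1" "Y * Z * W \<in> carrier_mat k k" using c by auto
    have 2: "bra dout i * X \<in> carrier_mat 1 dc" using c by auto
    have b: "(\<Sum>r<dout. bra dout i $$ (0,r) * X $$ (r,s)) = (\<Sum>r<dout. if r = i then X $$ (r,s) else 0)" for s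
      by (intro sum.cong) (auto simp: bra_def)
    have "mtrace (bra dout i * X * ket0 dc) = (\<Sum>s<dc. (\<Sum>r<dout. if r = i then X $$ (r,s) else 0) * ket0 dc $$ (s,0))"
      by (simp add: mtrace_eq[OF 1(1)] mult_index[OF 2 c(2)] mult_index[OF c(1) c(4)] b)
    also have "\<dots> = (\<Sum>s<dc. if s = 0 then X $$ (i,s) else 0)"
      using c(7) by (intro sum.cong) (auto simp: ket0_def sum.delta)
    also have "\<dots> = X $$ (i,0)" using dc by (simp add: sum.delta)
    finally have "mtrace (bra dout i * X * ket0 dc) = X $$ (i,0)" .
    moreover have "kron (bra dout i) Y * kron X Z * kron (ket0 dc) W = kron (bra dout i * X * ket0 dc) (Y * Z * W)"
      using kron_mult[OF c(1) c(4) c(3) c(5)] kron_mult[OF 2 c(2) mult_carrier_mat[OF c(3) c(5)] c(6)] by simp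
    ultimately show ?thesis by (simp add: mtrace_kron[OF 1] norm_mult power_mult_distrib)
  qed
  have "(\<Sum>B\<leftarrow>kraus_comp3 Ds' (kraus_tpow As (Suc n)) Es'. (cmod (mtrace B))\<^sup>2) =
    (\<Sum>i\<leftarrow>[0..<dout]. \<Sum>Y\<leftarrow>Ds. \<Sum>X\<leftarrow>As. \<Sum>Z\<leftarrow>kraus_tpow As n. \<Sum>W\<leftarrow>Es. (cmod (mtrace (kron (bra dout i) Y * kron X Z * kron (ket0 dc) W)))\<^sup>2)"
    by (simp add: sum_comp3 Es'_def Ds'_def sum_list_concat_map o_def)
  also have "\<dots> = (\<Sum>i\<leftarrow>[0..<dout]. \<Sum>Y\<leftarrow>Ds. \<Sum>X\<leftarrow>As. \<Sum>Z\<leftarrow>kraus_tpow As n. \<Sum>W\<leftarrow>Es. (cmod (X $$ (i,0)))\<^sup>2 * (cmod (mtrace (Y * Z * W)))\<^sup>2)"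
    using tr by (intro arg_cong[where f=sum_list] map_cong refl)
  also have "\<dots> = (\<Sum>i\<leftarrow>[0..<dout]. \<Sum>X\<leftarrow>As. (cmod (X $$ (i,0)))\<^sup>2) * (\<Sum>B\<leftarrow>kraus_comp3 Ds (kraus_tpow As n) Es. (cmod (mtrace B))\<^sup>2)"
    unfolding sum_comp3 sum_list_swap[where xs=Ds and ys=As] by (simp only: sum_list_mult_pull)
  also have "(\<Sum>i\<leftarrow>[0..<dout]. \<Sum>X\<leftarrow>As. (cmod (X $$ (i,0)))\<^sup>2) = 1"
    using is_channel_norm[OF A, of 0] dc
    by (subst sum_list_swap) (simp add: interv_sum_list_conv_sum_set_nat lessThan_atLeast0)
  finally show ?thesis using C' code_fid_eq[OF A C] code_fid_eq[OF A C'] by auto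
qed

lemma code_pad:
  assumes A: "is_channel dc dout As" and dc: "dc \<ge> 1" and C: "is_code dc dout n k Es Ds" and "n \<le> n'"
  shows "\<exists>Es' Ds'. is_code dc dout n' k Es' Ds' \<and> code_fid As n' k Es' Ds' = code_fid As n k Es Ds"
  using assms(4)
proof (induction n' rule: dec_induct)
  case base
  show ?case using C by blast
next
  case (step n')
  then show ?case using code_pad_Suc[OF A _ dc, of n' k] by metis
qed

text \<open>At length 0 the channel power is the scalar 1; padding carries its perfect
  one-dimensional code to every length.\<close>

lemma trivial_code:
  assumes A: "is_channel dc dout As" and dc: "dc \<ge> 1"
  shows "\<exists>Es Ds. is_code dc dout n 1 Es Ds \<and> code_fid As n 1 Es Ds = 1"
proof -
  have C: "is_code dc dout 0 1 [1\<^sub>m 1] [1\<^sub>m 1]"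
    using is_channel_one[of 1] by (simp add: is_code_def)
  have "code_fid As 0 1 [1\<^sub>m 1] [1\<^sub>m 1] = 1"
    by (subst code_fid_eq[OF A C]) (simp add: kraus_comp3_def mtrace_def)
  then show ?thesis using code_pad[OF A dc C, of n] by auto
qed

section \<open>Restriction of a code to fewer input dimensions\<close>

definition incl :: "nat \<Rightarrow> nat \<Rightarrow> complex mat" where
  "incl k q = mat k q (\<lambda>(r,c). if r = c then 1 else 0)"

lemma is_channel_incl: "q \<le> k \<Longrightarrow> is_channel q k [incl k q]"
  by (auto simp: is_channel_iff incl_def if_distrib[of cnj] if_distrib[of "\<lambda>x. _ * x"] if_distrib[of "\<lambda>x. x * _"] cong: if_cong)

definition unit_mat :: "nat \<Rightarrow> nat \<Rightarrow> nat \<Rightarrow> complex mat" where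
  "unit_mat q k i = mat q k (\<lambda>(r,c). if r = 0 \<and> c = i then 1 else 0)"

text \<open>The coordinate projection \<open>incl q k\<close> alone loses the trace on the basis
  vectors from \<open>q\<close> on; each \<open>unit_mat q k i\<close> compensates by sending one of
  them to basis vector 0.\<close>

lemma is_channel_restrict:
  assumes "1 \<le> q" "q \<le> k"
  shows "is_channel k q (incl q k # map (unit_mat q k) [q..<k])"
  unfolding is_channel_iff
proof (intro conjI ballI allI impI)
  fix i j assume ij: "i < k" "j < k"
  have 1: "(\<Sum>r<q. cnj (incl q k $$ (r, i)) * incl q k $$ (r, j)) = (if i = j \<and> i < q then 1 else 0)"
  proof -
    have "(\<Sum>r<q. cnj (incl q k $$ (r, i)) * incl q k $$ (r, j)) = (\<Sum>r<q. if r = i then if i = j then 1 else 0 else 0)"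
      using ij by (intro sum.cong refl) (auto simp: incl_def)
    then show ?thesis by (auto simp: sum.delta)
  qed
  have 2: "(\<Sum>r<q. cnj (unit_mat q k s $$ (r, i)) * unit_mat q k s $$ (r, j)) = (if s = i then if i = j then 1 else 0 else 0)" for s
  proof -
    have "(\<Sum>r<q. cnj (unit_mat q k s $$ (r, i)) * unit_mat q k s $$ (r, j)) = (\<Sum>r<q. if r = 0 then if s = i then if i = j then 1 else 0 else 0 else 0)"
      using ij by (intro sum.cong refl) (auto simp: unit_mat_def)
    then show ?thesis using assms by (auto simp: sum.delta)
  qed
  show "(\<Sum>K\<leftarrow>incl q k # map (unit_mat q k) [q..<k]. \<Sum>r<q. cnj (K $$ (r, i)) * K $$ (r, j)) = (if i = j then 1 else 0)"
    using ij by (auto simp: 1 2 o_def interv_sum_list_conv_sum_set_nat sum.delta)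
qed (auto simp: incl_def unit_mat_def)

text \<open>Cauchy-Schwarz with weights: (X + Y)^2 is at most (q + p) (X^2/q + Y^2/p). Replacing
  Y^2/p by \<open>S\<close> keeps the statement meaningful at p = 0, the case in which nothing is
  cut off.\<close>

lemma weighted_cauchy:
  fixes X Y S p q :: real
  assumes "q > 0" "p \<ge> 0" "S \<ge> 0" "Y\<^sup>2 \<le> p * S"
  shows "q * (X + Y)\<^sup>2 \<le> (q + p) * (X\<^sup>2 + q * S)"
proof (cases "p = 0")
  case True
  then have "Y = 0" using assms by simp

  then show ?thesis using True assms by (simp add: algebra_simps)
next
  case False
  then have p: "p > 0" using assms by simp
  \<comment> \<open>The two sides differ by (p X - q Y)^2.\<close>
  have "p * (q * (X + Y)\<^sup>2) \<le> (q + p) * (p * X\<^sup>2 + q * Y\<^sup>2)"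
    using zero_le_power2[of "p * X - q * Y"] by (simp add: power2_eq_square algebra_simps)
  also have "\<dots> \<le> (q + p) * (p * X\<^sup>2 + q * (p * S))"
    using assms p by (intro mult_left_mono add_left_mono) auto
  also have "\<dots> = p * ((q + p) * (X\<^sup>2 + q * S))" by (simp add: algebra_simps)
  finally show ?thesis using p by simp
qed

lemma norm_sum_squared_le: "(cmod (\<Sum>i\<in>A. f i))\<^sup>2 \<le> real (card A) * (\<Sum>i\<in>A. (cmod (f i))\<^sup>2)"
proof -
  have "(cmod (\<Sum>i\<in>A. f i))\<^sup>2 \<le> (\<Sum>i\<in>A. cmod (f i))\<^sup>2"
    by (intro power_mono norm_sum) auto
  also have "\<dots> = (\<Sum>i\<in>A. \<Sum>j\<in>A. cmod (f i) * cmod (f j))"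
    by (simp add: power2_eq_square sum_product)
  also have "\<dots> \<le> (\<Sum>i\<in>A. \<Sum>j\<in>A. ((cmod (f i))\<^sup>2 + (cmod (f j))\<^sup>2) / 2)"
    using sum_squares_bound[of "cmod (f _)" "cmod (f _)"] by (intro sum_mono) (simp add: field_simps)
  also have "\<dots> = real (card A) * (\<Sum>i\<in>A. (cmod (f i))\<^sup>2)"
    by (simp add: sum.distrib sum_divide_distrib[symmetric] sum_distrib_left[symmetric] add_divide_distrib)
  finally show ?thesis .
qed

text \<open>The trace splits into the first \<open>q\<close> diagonal entries and the other k - q,
  weighted accordingly. Columns of a channel have total squared norm 1, so each cut-off entry
  contributes at most 1. In terms of fidelities the bound reads q (1 - F_q) \<le> k (1 - F_k), for
  the block formed by the first \<open>q\<close> coordinates.\<close>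

lemma diagonal_block_fidelity:
  assumes B: "is_channel k k Bs" and q: "1 \<le> q" "q \<le> k"
  shows "(\<Sum>X\<leftarrow>Bs. (cmod (mtrace X))\<^sup>2) \<le> real k * ((\<Sum>X\<leftarrow>Bs. (cmod (\<Sum>i<q. X $$ (i,i)))\<^sup>2) / real q + (real k - real q))"
proof -
  define S where "S X = (\<Sum>i\<in>{q..<k}. (cmod (X $$ (i,i)))\<^sup>2)" for X :: "complex mat"
  have "(\<Sum>X\<leftarrow>Bs. (cmod (mtrace X))\<^sup>2) \<le> (\<Sum>X\<leftarrow>Bs. real k * ((cmod (\<Sum>i<q. X $$ (i,i)))\<^sup>2 / real q + S X))"
  proof (rule sum_list_mono)
    fix X assume "X \<in> set Bs"
    then have X: "X \<in> carrier_mat k k" using is_channelD(1)[OF B] by auto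
    let ?x = "\<Sum>i<q. X $$ (i,i)" and ?y = "\<Sum>i\<in>{q..<k}. X $$ (i,i)"
    have "mtrace X = ?x + ?y"
      using q by (simp add: mtrace_eq[OF X] lessThan_atLeast0 sum.atLeastLessThan_concat)
    then have "(cmod (mtrace X))\<^sup>2 \<le> (cmod ?x + cmod ?y)\<^sup>2"
      by (intro power_mono) (auto intro: norm_triangle_ineq)
    moreover have "real q * (cmod ?x + cmod ?y)\<^sup>2 \<le> (real q + real (k - q)) * ((cmod ?x)\<^sup>2 + real q * S X)"
      using q norm_sum_squared_le[of "\<lambda>i. X $$ (i,i)" "{q..<k}"]
      by (intro weighted_cauchy) (auto simp: S_def intro: sum_nonneg)
    ultimately have "real q * (cmod (mtrace X))\<^sup>2 \<le> real k * ((cmod ?x)\<^sup>2 + real q * S X)"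
      using q order_trans[OF mult_left_mono[of "(cmod (mtrace X))\<^sup>2" "(cmod ?x + cmod ?y)\<^sup>2" "real q"]]
      by (simp only: of_nat_diff) simp
    then show "(cmod (mtrace X))\<^sup>2 \<le> real k * ((cmod ?x)\<^sup>2 / real q + S X)"
      using q by (simp add: field_simps)
  qed
  also have "\<dots> = real k * ((\<Sum>X\<leftarrow>Bs. (cmod (\<Sum>i<q. X $$ (i,i)))\<^sup>2) / real q + (\<Sum>X\<leftarrow>Bs. S X))"
    unfolding divide_inverse sum_list_mult_pull sum_list_addf ..
  also have "(\<Sum>X\<leftarrow>Bs. S X) \<le> real k - real q"
  proof -
    have "(\<Sum>X\<leftarrow>Bs. S X) \<le> (\<Sum>X\<leftarrow>Bs. \<Sum>i\<in>{q..<k}. \<Sum>r<k. (cmod (X $$ (r,i)))\<^sup>2)"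
      unfolding S_def
      by (intro sum_list_mono sum_mono member_le_sum[where f="\<lambda>r. (cmod (_ $$ (r,_)))\<^sup>2"]) auto
    also have "\<dots> = (\<Sum>i\<in>{q..<k}. \<Sum>X\<leftarrow>Bs. \<Sum>r<k. (cmod (X $$ (r,i)))\<^sup>2)"
      by (rule sum_list_sum_swap)
    also have "\<dots> = (\<Sum>i\<in>{q..<k}. 1)"
      by (intro sum.cong refl is_channel_norm[OF B]) auto
    finally show ?thesis using q by (simp add: of_nat_diff)
  qed
  finally show ?thesis using q by (simp add: mult_left_mono)
qed

lemma mtrace_incl:
  assumes "X \<in> carrier_mat k k" "q \<le> k"
  shows "mtrace (incl q k * X * incl k q) = (\<Sum>i<q. X $$ (i,i))"
proof -
  have c: "incl q k \<in> carrier_mat q k" "incl k q \<in> carrier_mat k q" by (auto simp: incl_def)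
  note c1 = mult_carrier_mat[OF c(1) assms(1)] and c2 = mult_carrier_mat[OF mult_carrier_mat[OF c(1) assms(1)] c(2)]
  have "mtrace (incl q k * X * incl k q) = (\<Sum>i<q. \<Sum>s<k. (\<Sum>r<k. incl q k $$ (i,r) * X $$ (r,s)) * incl k q $$ (s,i))"
    by (simp add: mtrace_eq[OF c2] mult_index[OF c1 c(2)] mult_index[OF c(1) assms(1)])
  also have "\<dots> = (\<Sum>i<q. X $$ (i,i))"
  proof (intro sum.cong refl)
    fix i assume i: "i \<in> {..<q}"
    have "(\<Sum>r<k. incl q k $$ (i,r) * X $$ (r,s)) = (\<Sum>r<k. if r = i then X $$ (r,s) else 0)" for s
      using i by (intro sum.cong) (auto simp: incl_def)
    then have "(\<Sum>s<k. (\<Sum>r<k. incl q k $$ (i,r) * X $$ (r,s)) * incl k q $$ (s,i)) = (\<Sum>s<k. if s = i then X $$ (i,s) else 0)"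
      using i assms(2) by (intro sum.cong) (auto simp: incl_def sum.delta)
    then show "(\<Sum>s<k. (\<Sum>r<k. incl q k $$ (i,r) * X $$ (r,s)) * incl k q $$ (s,i)) = X $$ (i,i)"
      using i assms(2) by (simp add: sum.delta)
  qed
  finally show ?thesis .
qed

lemma code_restrict:
  assumes A: "is_channel dc dout As" and C: "is_code dc dout n k Es Ds" and q: "1 \<le> q" "q \<le> k"
  shows "\<exists>Es' Ds'. is_code dc dout n q Es' Ds' \<and>
    real q * (1 - code_fid As n q Es' Ds') \<le> real k * (1 - code_fid As n k Es Ds)"
proof -
  define Es' where "Es' = [E * J. E \<leftarrow> Es, J \<leftarrow> [incl k q]]"
  define Qs where "Qs = incl q k # map (unit_mat q k) [q..<k]"
  define Ds' where "Ds' = [Q * D. Q \<leftarrow> Qs, D \<leftarrow> Ds]"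
  define Bs where "Bs = kraus_comp3 Ds (kraus_tpow As n) Es"
  have E: "is_channel k (dc^n) Es" and D: "is_channel (dout^n) k Ds" and k: "k \<ge> 1" using C by (auto simp: is_code_def)
  have C': "is_code dc dout n q Es' Ds'"
    using is_channel_compose[OF E is_channel_incl[OF q(2)]] is_channel_compose[OF is_channel_restrict[OF q] D] q
    by (simp add: is_code_def Es'_def Ds'_def Qs_def)
  note T = is_channel_tpow[OF A, of n]
  have B: "is_channel k k Bs" unfolding Bs_def by (rule is_channel_code[OF A C])
  have "(\<Sum>X\<leftarrow>Bs. (cmod (\<Sum>i<q. X $$ (i,i)))\<^sup>2) = (\<Sum>X\<leftarrow>Bs. (cmod (mtrace (incl q k * X * incl k q)))\<^sup>2)"
    using is_channelD(1)[OF B] by (intro arg_cong[where f=sum_list] map_cong refl) (simp add: mtrace_incl[OF _ q(2)])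
  also have "\<dots> = (\<Sum>D\<leftarrow>Ds. \<Sum>A\<leftarrow>kraus_tpow As n. \<Sum>E\<leftarrow>Es. (cmod (mtrace (incl q k * (D * A * E) * incl k q)))\<^sup>2)"
    by (simp add: Bs_def sum_comp3)
  also have "\<dots> = (\<Sum>D\<leftarrow>Ds. \<Sum>A\<leftarrow>kraus_tpow As n. \<Sum>E\<leftarrow>Es. (cmod (mtrace (incl q k * D * A * (E * incl k q))))\<^sup>2)"
  proof (intro arg_cong[where f=sum_list] map_cong refl)
    fix X Y Z assume "X \<in> set Ds" "Y \<in> set (kraus_tpow As n)" "Z \<in> set Es"
    then have c: "X \<in> carrier_mat k (dout^n)" "Y \<in> carrier_mat (dout^n) (dc^n)" "Z \<in> carrier_mat (dc^n) k"
      using is_channelD(1)[OF D] is_channelD(1)[OF E] is_channelD(1)[OF T] by auto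
    have i: "incl q k \<in> carrier_mat q k" "incl k q \<in> carrier_mat k q" by (auto simp: incl_def)
    have "incl q k * (X * Y * Z) * incl k q = incl q k * X * Y * Z * incl k q"
      using assoc_mult_mat[OF i(1) mult_carrier_mat[OF c(1,2)] c(3)] assoc_mult_mat[OF i(1) c(1,2)] by simp
    also have "\<dots> = incl q k * X * Y * (Z * incl k q)"
      using c i by (intro assoc_mult_mat[of _ q "dc^n" _ k _ q]) auto
    finally show "(cmod (mtrace (incl q k * (X * Y * Z) * incl k q)))\<^sup>2 = (cmod (mtrace (incl q k * X * Y * (Z * incl k q))))\<^sup>2"
      by simp
  qed
  \<comment> \<open>The decoder operators built from \<open>unit_mat\<close> only add nonnegative
    terms.\<close>
  also have "\<dots> \<le> (\<Sum>X\<leftarrow>kraus_comp3 Ds' (kraus_tpow As n) Es'. (cmod (mtrace X))\<^sup>2)"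
    by (auto simp: sum_comp3 Ds'_def Es'_def Qs_def sum_list_concat_map o_def intro!: sum_list_nonneg)
  also have "\<dots> = (real q)\<^sup>2 * code_fid As n q Es' Ds'"
    using q by (simp add: code_fid_eq[OF A C'])
  finally have le: "(\<Sum>X\<leftarrow>Bs. (cmod (\<Sum>i<q. X $$ (i,i)))\<^sup>2) \<le> (real q)\<^sup>2 * code_fid As n q Es' Ds'" .
  have "real k * (real k * code_fid As n k Es Ds) = (\<Sum>X\<leftarrow>Bs. (cmod (mtrace X))\<^sup>2)"
    using k by (simp add: code_fid_eq[OF A C] Bs_def power2_eq_square)
  also have "\<dots> \<le> real k * ((\<Sum>X\<leftarrow>Bs. (cmod (\<Sum>i<q. X $$ (i,i)))\<^sup>2) / real q + (real k - real q))"
    by (rule diagonal_block_fidelity[OF B q])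
  also have "\<dots> \<le> real k * ((real q)\<^sup>2 * code_fid As n q Es' Ds' / real q + (real k - real q))"
    using le by (intro mult_left_mono add_right_mono divide_right_mono) auto
  finally have "real k * code_fid As n k Es Ds \<le> real q * code_fid As n q Es' Ds' + (real k - real q)"
    using k q by (simp add: power2_eq_square)
  then show ?thesis using C' by (auto simp: algebra_simps)
qed

section \<open>Bit strings, characters and a CSS-like construction\<close>

lemma xor_cancel_left [simp]: "xor a (xor a b) = (b::nat)"
  by (simp add: xor.assoc[symmetric])

lemma xor_eq_0_iff_nat [simp]: "xor a b = 0 \<longleftrightarrow> a = (b::nat)"
  by (metis xor_cancel_left xor.right_neutral xor_self_eq)

lemma xor_less_exp: "a < 2^N \<Longrightarrow> b < 2^N \<Longrightarrow> xor a b < (2^N::nat)"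
  by (metis take_bit_nat_eq_self_iff take_bit_xor)

lemma sum_xor_shift:
  assumes "\<And>x. x \<in> C \<Longrightarrow> xor a x \<in> C"
  shows "(\<Sum>x\<in>C. f (xor a x)) = (\<Sum>x\<in>C. f (x::nat))"
  by (rule sum.reindex_bij_witness[of _ "xor a" "xor a"]) (auto simp: assms)

text \<open>The character (-1)^(b . x) of the group of N-bit strings under \<open>xor\<close>, where
  b . x counts the common one bits; bits from position \<open>N\<close> on are ignored.\<close>

definition chi :: "nat \<Rightarrow> nat \<Rightarrow> nat \<Rightarrow> real" where
  "chi N b x = (\<Prod>i<N. if bit b i \<and> bit x i then -1 else 1)"

lemma chi_commute: "chi N b x = chi N x b"
  by (simp add: chi_def conj_commute)

lemma chi_xor: "chi N b (xor x y) = chi N b x * chi N b y"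
  by (auto simp: chi_def prod.distrib[symmetric] bit_xor_iff intro!: prod.cong)

lemma chi_xor_left: "chi N (xor x y) b = chi N x b * chi N y b"
  by (simp add: chi_commute[of _ _ b] chi_xor)

lemma chi_0 [simp]: "chi N 0 x = 1" "chi N x 0 = 1"
  by (auto simp: chi_def)

lemma chi_self [simp]: "chi N b x * chi N b x = 1"
  by (simp add: chi_xor[symmetric])

lemma chi_cases: "chi N b x = 1 \<or> chi N b x = -1"
  using chi_self[of N b x] square_eq_1_iff by blast

lemma chi_nontrivial:
  assumes "b < 2^N" "b \<noteq> 0"
  shows "\<exists>x<2^N. chi N b x = -1"
proof -
  obtain i where i: "bit b i" using assms(2) by (metis bit_eq_iff bit_0_eq bot_apply bot_bool_def)
  have "i < N" using i assms(1) by (metis bit_take_bit_iff take_bit_nat_eq_self_iff)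
  have "chi N b (2^i) = (\<Prod>j<N. if j = i then -1 else 1)"
    unfolding chi_def using i by (intro prod.cong) (auto simp: bit_exp_iff)
  also have "\<dots> = -1" using \<open>i < N\<close> by (simp add: prod.delta)
  finally show ?thesis using \<open>i < N\<close> by (intro exI[of _ "2^i"]) simp
qed

text \<open>Translation by \<open>c\<close> permutes \<open>C\<close> and multiplies the sum by
  \<open>chi N b c\<close>, which is -1.\<close>

lemma chi_sum_subgroup:
  assumes "\<And>x y. x \<in> C \<Longrightarrow> y \<in> C \<Longrightarrow> xor x y \<in> C" "c \<in> C" "chi N b c \<noteq> 1"
  shows "(\<Sum>x\<in>C. chi N b x) = 0"
proof -
  have "(\<Sum>x\<in>C. chi N b x) = (\<Sum>x\<in>C. chi N b (xor c x))"
    using assms by (intro sum_xor_shift[symmetric]) auto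
  also have "\<dots> = - (\<Sum>x\<in>C. chi N b x)"
    using assms(3) chi_cases[of N b c] by (simp add: chi_xor sum_negf)
  finally show ?thesis by simp
qed

lemma chi_sum:
  assumes "b < 2^N"
  shows "(\<Sum>x<2^N. chi N b x) = (if b = 0 then 2^N else 0)"
proof (cases "b = 0")
  case False
  then obtain x where "x < 2^N" "chi N b x = -1" using chi_nontrivial[OF assms] by auto
  then show ?thesis using False chi_sum_subgroup[of "{..<2^N}" x N b] by (simp add: xor_less_exp)
qed simp

text \<open>Excluded \<open>g\<close> have the form \<open>xor c d\<close> with \<open>c\<close> in
  \<open>C\<close> and \<open>d\<close> in \<open>\<Delta>\<close>, so they fill at most a quarter
  of the space. Each nonzero \<open>b\<close> has \<open>chi N b g = 1\<close> for exactly half of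
  all \<open>g\<close>. Over the other three quarters, the mean share of \<open>B\<close> that stays
  trivial is thus at most (1/2) / (3/4) = 2/3.\<close>

lemma xor_subgroup_step:
  assumes D: "\<Delta> \<subseteq> {1..<2^N}" and C: "C \<subseteq> {..<2^N}" and le: "4 * (card C * card \<Delta>) \<le> 2^N"
    and B: "B \<subseteq> \<Delta>"
  shows "\<exists>g<2^N. (\<forall>c\<in>C. xor g c \<notin> \<Delta>) \<and> 3 * card {b\<in>B. chi N b g = 1} \<le> 2 * card B"
proof (rule ccontr)
  assume neg: "\<not> ?thesis"
  define G where "G = {g. g < 2^N \<and> (\<forall>c\<in>C. xor g c \<notin> \<Delta>)}"
  have fin: "finite \<Delta>" "finite C" "finite B" "finite G"
    using D C B by (auto simp: G_def intro: finite_subset)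
  let ?F = "(\<lambda>(c,d). xor c d) ` (C \<times> \<Delta>)"
  have "{..<2^N} \<subseteq> G \<union> ?F"
  proof
    fix g :: nat assume "g \<in> {..<2^N}"
    then show "g \<in> G \<union> ?F"
      by (auto simp: G_def image_iff) (metis xor.commute xor_cancel_left)
  qed
  then have "card {..<2^N::nat} \<le> card (G \<union> ?F)" using fin by (intro card_mono) auto
  also have "\<dots> \<le> card G + card ?F" by (rule card_Un_le)
  also have "card ?F \<le> card (C \<times> \<Delta>)" using fin by (intro card_image_le) auto
  finally have G: "3 * 2^N \<le> 4 * card G" using le by (simp add: card_cartesian_product)
  then have ne: "G \<noteq> {}" by auto
  have ind: "real (card {b\<in>B. chi N b g = 1}) = (\<Sum>b\<in>B. (1 + chi N b g) / 2)" for g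
  proof -
    have "real (card {b\<in>B. chi N b g = 1}) = (\<Sum>b\<in>B. if chi N b g = 1 then 1 else 0)"
      using fin by (simp add: sum.If_cases Int_def)
    also have "\<dots> = (\<Sum>b\<in>B. (1 + chi N b g) / 2)"
    proof (intro sum.cong refl)
      show "(if chi N b g = 1 then 1 else 0) = (1 + chi N b g) / 2" for b
        using chi_cases[of N b g] by auto
    qed
    finally show ?thesis .
  qed
  have "(\<Sum>g\<in>G. real (2 * card B)) < (\<Sum>g\<in>G. real (3 * card {b\<in>B. chi N b g = 1}))"
    using neg fin ne by (intro sum_strict_mono) (auto simp: G_def not_le simp del: of_nat_mult)
  also have "\<dots> \<le> (\<Sum>g<2^N. real (3 * card {b\<in>B. chi N b g = 1}))"
    by (intro sum_mono2) (auto simp: G_def)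
  also have "\<dots> = 3 * (\<Sum>b\<in>B. \<Sum>g<2^N. (1 + chi N b g) / 2)"
    by (simp add: ind sum_distrib_left[symmetric] sum.swap[of _ B])
  also have "(\<Sum>b\<in>B. \<Sum>g<2^N. (1 + chi N b g) / 2) = (\<Sum>b\<in>B. 2^N / 2)"
  proof (intro sum.cong refl)
    fix b assume "b \<in> B"
    then have "b < 2^N" "b \<noteq> 0" using B D by auto
    then show "(\<Sum>g<2^N. (1 + chi N b g) / 2) = 2^N / 2"
      using chi_sum[of b N] by (simp add: sum_divide_distrib[symmetric] sum.distrib)
  qed
  finally have "real (card G) * (2 * real (card B)) < 3 * 2^N / 2 * real (card B)" by (simp add: mult_ac)
  moreover have "3 * 2^N / 2 * real (card B) \<le> (2 * real (card G)) * real (card B)"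
    using of_nat_mono[OF G, where 'a=real] by (intro mult_right_mono) auto
  ultimately show False by simp
qed

text \<open>Adjoining \<open>g\<close> at most doubles the subgroup and leaves at most 2/3 of the
  characters trivial on it. After 2 L steps fewer than (4/9)^L 2^L = (8/9)^L \<le> 1 characters from
  \<open>\<Delta>\<close> are trivial, hence none. Disjointness from \<open>\<Delta>\<close> will
  separate bit flips, the nontrivial characters will separate phase flips.\<close>

lemma xor_subgroup_exists:
  assumes D: "\<Delta> \<subseteq> {1..<2^N}" and card: "card \<Delta> < 2^L" and N: "3*L+2 \<le> N"
  shows "\<exists>C. C \<subseteq> {..<2^N} \<and> 0 \<in> C \<and> (\<forall>x\<in>C. \<forall>y\<in>C. xor x y \<in> C) \<and> card C \<le> 2^(2*L) \<and>
    C \<inter> \<Delta> = {} \<and> (\<forall>b\<in>\<Delta>. \<exists>c\<in>C. chi N b c \<noteq> 1)"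
proof -
  have fD: "finite \<Delta>" using D finite_subset by blast
  have "\<exists>C. C \<subseteq> {..<2^N} \<and> 0 \<in> C \<and> (\<forall>x\<in>C. \<forall>y\<in>C. xor x y \<in> C) \<and> card C \<le> 2^r \<and>
    C \<inter> \<Delta> = {} \<and> card {b\<in>\<Delta>. \<forall>c\<in>C. chi N b c = 1} * 3^r \<le> 2^r * card \<Delta>" if "r \<le> 2*L" for r
    using that
  proof (induction r)
    case 0
    show ?case using D by (intro exI[of _ "{0}"]) auto
  next
    case (Suc r)
    then obtain C where C: "C \<subseteq> {..<2^N}" "0 \<in> C" "\<forall>x\<in>C. \<forall>y\<in>C. xor x y \<in> C" "card C \<le> 2^r"
      "C \<inter> \<Delta> = {}" "card {b\<in>\<Delta>. \<forall>c\<in>C. chi N b c = 1} * 3^r \<le> 2^r * card \<Delta>" by auto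
    let ?B = "{b\<in>\<Delta>. \<forall>c\<in>C. chi N b c = 1}"
    have "4 * (card C * card \<Delta>) \<le> 4 * (2^r * 2^L)" using C(4) card by (intro mult_le_mono) auto
    also have "\<dots> = 2^(r+L+2)" by (simp add: power_add)
    also have "\<dots> \<le> 2^N" using Suc.prems N by (intro power_increasing) auto
    finally obtain g where g: "g < 2^N" "\<forall>c\<in>C. xor g c \<notin> \<Delta>" "3 * card {b\<in>?B. chi N b g = 1} \<le> 2 * card ?B"
      using xor_subgroup_step[OF D C(1), of ?B] by auto
    let ?C = "C \<union> xor g ` C"
    have "card ?C \<le> card C + card (xor g ` C)" by (rule card_Un_le)
    also have "\<dots> \<le> 2 * 2^r" using C card_image_le[of C "xor g"] finite_subset[OF C(1)] by simp
    finally have c1: "card ?C \<le> 2^Suc r" by simp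
    have c2: "\<forall>x\<in>?C. \<forall>y\<in>?C. xor x y \<in> ?C"
      using C(3) by (auto simp: xor.assoc xor.left_commute[of _ g])
    have "{b\<in>\<Delta>. \<forall>c\<in>?C. chi N b c = 1} \<subseteq> {b\<in>?B. chi N b g = 1}"
    proof
      fix b assume b: "b \<in> {b\<in>\<Delta>. \<forall>c\<in>?C. chi N b c = 1}"
      then have "chi N b (xor g 0) = 1" using C(2) by blast
      then show "b \<in> {b\<in>?B. chi N b g = 1}" using b by auto
    qed
    then have "card {b\<in>\<Delta>. \<forall>c\<in>?C. chi N b c = 1} \<le> card {b\<in>?B. chi N b g = 1}"
      using fD by (intro card_mono) auto
    then have "card {b\<in>\<Delta>. \<forall>c\<in>?C. chi N b c = 1} * 3^Suc r \<le> (3 * card {b\<in>?B. chi N b g = 1}) * 3^r"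
      by simp
    also have "\<dots> \<le> (2 * card ?B) * 3^r" using g(3) by (intro mult_le_mono1)
    also have "\<dots> \<le> 2^Suc r * card \<Delta>" using C(6) by simp
    finally show ?case using C g c1 c2 by (intro exI[of _ ?C]) (auto simp: xor_less_exp)
  qed
  from this[of "2*L"] obtain C where C: "C \<subseteq> {..<2^N}" "0 \<in> C" "\<forall>x\<in>C. \<forall>y\<in>C. xor x y \<in> C" "card C \<le> 2^(2*L)"
      "C \<inter> \<Delta> = {}" "card {b\<in>\<Delta>. \<forall>c\<in>C. chi N b c = 1} * 3^(2*L) \<le> 2^(2*L) * card \<Delta>" by auto
  have "2^(2*L) * card \<Delta> < 2^(2*L) * 2^L" using card by simp
  also have "\<dots> = 8^L" by (simp add: power_mult power_mult_distrib[symmetric])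
  also have "\<dots> \<le> 9^L" by (intro power_mono) auto
  finally have less: "2^(2*L) * card \<Delta> < 1 * 9^L" by (simp only: mult_1)
  have "(3::nat)^(2*L) = 9^L" by (simp add: power_mult)
  from C(6)[unfolded this] less have "card {b\<in>\<Delta>. \<forall>c\<in>C. chi N b c = 1} * 9^L < 1 * 9^L"
    by (rule le_less_trans)
  then have "card {b\<in>\<Delta>. \<forall>c\<in>C. chi N b c = 1} = 0" by simp
  then have "{b\<in>\<Delta>. \<forall>c\<in>C. chi N b c = 1} = {}" using fD by simp
  then show ?thesis using C by (intro exI[of _ C]) auto
qed

text \<open>A Gilbert-Varshamov argument: at most K |C| |D| points conflict with \<open>K\<close>
  chosen ones, fewer than 2^N if the count still admits one more. When 0 is in \<open>D\<close>, as
  in the application, the cosets are in particular distinct.\<close>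

lemma coset_packing:
  assumes "finite C" "finite D" "D \<subseteq> {..<2^N}" "C \<subseteq> {..<2^N}" "K * (card C * card D) \<le> 2^N"
  shows "\<exists>f. (\<forall>i<K. f i < 2^N) \<and> (\<forall>i<K. \<forall>j<K. i \<noteq> j \<longrightarrow> (\<forall>c\<in>C. xor (xor (f i) (f j)) c \<notin> (D::nat set)))"
  using assms(5)
proof (induction K)
  case (Suc K)
  show ?case
  proof (cases "card C * card D = 0")
    \<comment> \<open>Nothing is excluded when \<open>C\<close> or \<open>D\<close> is empty, and
      the strict count of the other case would fail.\<close>
    case True
    then show ?thesis using assms(1,2) by (intro exI[of _ "\<lambda>_. 0"]) auto
  next
    case False
    obtain f where f: "\<forall>i<K. f i < 2^N" "\<forall>i<K. \<forall>j<K. i \<noteq> j \<longrightarrow> (\<forall>c\<in>C. xor (xor (f i) (f j)) c \<notin> D)"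
      using Suc by auto
    let ?F = "(\<lambda>(i,c,d). xor (xor (f i) c) d) ` ({..<K} \<times> C \<times> D)"
    have fF: "finite ?F" using assms by auto
    have "card ?F \<le> card ({..<K} \<times> C \<times> D)" using assms by (intro card_image_le) auto
    also have "\<dots> < 2^N" using Suc.prems False
      by (simp only: card_cartesian_product card_lessThan mult_Suc)
    finally have "\<not> {..<2^N} \<subseteq> ?F" using card_mono[OF fF, of "{..<2^N}"] by auto
    then obtain x where x: "x < 2^N" "x \<notin> ?F" by auto
    have 1: "xor (xor (f i) x) c \<notin> D" "xor (xor x (f i)) c \<notin> D" if "i < K" "c \<in> C" for i c
    proof -
      have "x = xor (xor (f i) c) (xor (xor (f i) x) c)"
        by (simp add: xor.assoc xor.left_commute xor.commute)
      then show "xor (xor (f i) x) c \<notin> D" using x(2) that by (force simp: image_iff)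
      then show "xor (xor x (f i)) c \<notin> D" by (simp add: xor.commute)
    qed
    show ?thesis using f x(1) 1
      by (intro exI[of _ "f(K := x)"]) (auto simp: less_Suc_eq)
  qed
qed auto

text \<open>Column \<open>j\<close> of \<open>V\<close> is the uniform superposition over the coset
  of \<open>f j\<close>. The conclusion is a nondegenerate form of the Knill-Laflamme conditions:
  distinct errors whose bit and phase differences lie in \<open>insert 0 \<Delta>\<close> map the
  code to orthogonal spaces. Of the 3 L lost qubits, 2 L pay for the size of \<open>C\<close> and L
  for keeping the cosets apart.\<close>

lemma css_code_exists:
  assumes D: "\<Delta> \<subseteq> {1..<2^N}" and card: "card \<Delta> < 2^L" and N: "3*L+2 \<le> N"
  shows "\<exists>V::nat \<Rightarrow> nat \<Rightarrow> real. \<forall>a b a' b' i j. a < 2^N \<longrightarrow> b < 2^N \<longrightarrow> a' < 2^N \<longrightarrow> b' < 2^N \<longrightarrow>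
     xor a a' \<in> insert 0 \<Delta> \<longrightarrow> xor b b' \<in> insert 0 \<Delta> \<longrightarrow> i < 2^(N-3*L) \<longrightarrow> j < 2^(N-3*L) \<longrightarrow>
     (\<Sum>y<2^N. (chi N b (xor y a) * V (xor y a) i) * (chi N b' (xor y a') * V (xor y a') j))
       = (if i = j \<and> a = a' \<and> b = b' then 1 else 0)"
proof -
  obtain C where C: "C \<subseteq> {..<2^N}" "0 \<in> C" "\<forall>x\<in>C. \<forall>y\<in>C. xor x y \<in> C" "card C \<le> 2^(2*L)"
      "C \<inter> \<Delta> = {}" "\<forall>b\<in>\<Delta>. \<exists>c\<in>C. chi N b c \<noteq> 1" using xor_subgroup_exists[OF D card N] by auto
  define K :: nat where "K = 2^(N-3*L)"
  have fin: "finite C" "finite \<Delta>" using C(1) D finite_subset by blast+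
  have D': "finite (insert 0 \<Delta>)" "insert 0 \<Delta> \<subseteq> {..<2^N}" using fin D by auto
  have "K * (card C * card (insert 0 \<Delta>)) \<le> K * (2^(2*L) * 2^L)"
    using C(4) card fin by (intro mult_le_mono) (auto simp: card_insert_if)
  also have "\<dots> = 2^N" unfolding K_def power_add[symmetric] using N by simp
  finally obtain f where f: "\<forall>i<K. f i < 2^N" "\<forall>i<K. \<forall>j<K. i \<noteq> j \<longrightarrow> (\<forall>c\<in>C. xor (xor (f i) (f j)) c \<notin> insert 0 \<Delta>)"
    using coset_packing[of C "insert 0 \<Delta>" N K] fin C(1) D' by blast
  have cpos: "card C > 0" using fin C(2) by (auto simp: card_gt_0_iff)
  define V where "V x j = (if xor x (f j) \<in> C then 1 / sqrt (card C) else 0)" for x j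
  have main: "(\<Sum>y<2^N. (chi N b (xor y a) * V (xor y a) i) * (chi N b' (xor y a') * V (xor y a') j))
       = (if i = j \<and> a = a' \<and> b = b' then 1 else 0)"
    if *: "a < 2^N" "b < 2^N" "a' < 2^N" "b' < 2^N" "xor a a' \<in> insert 0 \<Delta>" "xor b b' \<in> insert 0 \<Delta>" "i < K" "j < K"
    for a b a' b' i j
  proof (cases "i = j \<and> a = a'")
    case False
    \<comment> \<open>The supports are disjoint: a common point \<open>y\<close> cancels and puts
      \<open>xor (xor a a') (xor (f i) (f j))\<close> in \<open>C\<close>, against
      \<open>C \<inter> \<Delta> = {}\<close> if i = j and against the packing otherwise.\<close>
    have "V (xor y a) i * V (xor y a') j = 0" for y
    proof (rule ccontr)
      assume "V (xor y a) i * V (xor y a') j \<noteq> 0"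
      then have "xor (xor y a) (f i) \<in> C" "xor (xor y a') (f j) \<in> C" by (auto simp: V_def split: if_splits)
      then have c: "xor (xor (xor y a) (f i)) (xor (xor y a') (f j)) \<in> C" (is "?c \<in> C") using C(3) by blast
      have e: "xor a a' = xor (xor (f i) (f j)) ?c"
        by (simp add: xor.assoc xor.left_commute xor.commute)
      show False
      proof (cases "i = j")
        case True
        then have "xor a a' \<in> C" using e c by simp
        then show False using *(5) C(5) True False by auto
      next
        case False
        then show False using f(2) *(5,7,8) c e by metis
      qed
    qed
    then have "(chi N b (xor y a) * V (xor y a) i) * (chi N b' (xor y a') * V (xor y a') j) = 0" for y
      by (metis mult_eq_0_iff)
    then show ?thesis using False by (simp only: sum.neutral_const) auto
  next
    case True
    \<comment> \<open>The supports now coincide and only the relative phase \<open>e\<close>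
      matters: up to a constant the sum is a character sum over \<open>C\<close>, which vanishes for
      \<open>e\<close> in \<open>\<Delta>\<close>.\<close>
    define e where "e = xor b b'"
    define F where "F z = chi N e (xor z (f i)) * (if z \<in> C then 1 / card C else 0)" for z
    have "(\<Sum>y<2^N. (chi N b (xor y a) * V (xor y a) i) * (chi N b' (xor y a') * V (xor y a') j))
      = (\<Sum>y<2^N. F (xor (xor a (f i)) y))"
    proof (intro sum.cong refl)
      fix y
      have "xor (xor (xor a (f i)) y) (f i) = xor y a" "xor (xor a (f i)) y = xor (xor y a) (f i)"
        by (simp_all add: xor.assoc xor.left_commute xor.commute)
      then show "(chi N b (xor y a) * V (xor y a) i) * (chi N b' (xor y a') * V (xor y a') j) = F (xor (xor a (f i)) y)"
        using True cpos by (simp add: F_def V_def e_def chi_xor_left)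
    qed
    also have "\<dots> = (\<Sum>z<2^N. F z)"
      using * f(1) by (intro sum_xor_shift) (auto simp: xor_less_exp)
    also have "\<dots> = (\<Sum>z\<in>C. F z)"
      using C(1) by (intro sum.mono_neutral_right) (auto simp: F_def)
    also have "\<dots> = (\<Sum>z\<in>C. chi N e z) * (chi N e (f i) / card C)"
      by (simp add: F_def chi_xor sum_distrib_right sum_divide_distrib)
    also have "\<dots> = (if b = b' then 1 else 0)"
    proof (cases "b = b'")
      case True
      then show ?thesis using cpos by (simp add: e_def)
    next
      case False
      then have "e \<in> \<Delta>" using *(6) by (simp add: e_def)
      then obtain c where "c \<in> C" "chi N e c \<noteq> 1" using C(6) by blast
      then have "(\<Sum>z\<in>C. chi N e z) = 0" using C(3) by (intro chi_sum_subgroup) auto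
      then show ?thesis using False by simp
    qed
    finally show ?thesis using True by simp
  qed
  show ?thesis using main unfolding K_def by (intro exI[of _ V]) blast
qed

section \<open>Pauli twirling\<close>

text \<open>The operator \<open>X^a Z^b\<close>, with bit strings coded as natural numbers.\<close>

definition pauli :: "nat \<Rightarrow> nat \<Rightarrow> nat \<Rightarrow> complex mat" where
  "pauli N a b = mat (2^N) (2^N) (\<lambda>(x,y). if x = xor y a then of_real (chi N b y) else 0)"

text \<open>The coefficient of \<open>T\<close> in the Pauli basis, tr(P^dagger T) / 2^N for P =
  \<open>pauli N a b\<close>.\<close>

definition pauli_coeff :: "nat \<Rightarrow> nat \<Rightarrow> nat \<Rightarrow> complex mat \<Rightarrow> complex" where
  "pauli_coeff N a b T = (\<Sum>z<2^N. of_real (chi N b z) * T $$ (xor z a, z)) / 2^N"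

lemma pauli_carrier [simp]: "pauli N a b \<in> carrier_mat (2^N) (2^N)"
  by (simp add: pauli_def)

lemma eq_xor_iff: "x = xor y a \<longleftrightarrow> y = xor x (a::nat)"
  by (metis xor.commute xor_cancel_left)

lemma xor_cancel_right [simp]: "xor (xor a b) b = (a::nat)"
  by (simp add: xor.assoc)

lemma pauli_index: "x < 2^N \<Longrightarrow> y < 2^N \<Longrightarrow> pauli N a b $$ (x,y) = (if y = xor x a then of_real (chi N b y) else 0)"
  by (auto simp: pauli_def)

lemma cadj_pauli_index:
  "x < 2^N \<Longrightarrow> y < 2^N \<Longrightarrow> cadj (pauli N a b) $$ (x,y) = (if y = xor x a then of_real (chi N b x) else 0)"
  by (subst cadj_index[OF pauli_carrier]) (auto simp: pauli_def)

lemma pauli_mult_index: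
  assumes "W \<in> carrier_mat (2^N) K" "x < 2^N" "a < 2^N" "i < K"
  shows "(pauli N a b * W) $$ (x,i) = of_real (chi N b (xor x a)) * W $$ (xor x a, i)"
proof -
  have "(pauli N a b * W) $$ (x,i) = (\<Sum>y<2^N. pauli N a b $$ (x,y) * W $$ (y,i))"
    by (rule mult_index[OF pauli_carrier assms(1,2,4)])
  also have "\<dots> = (\<Sum>y<2^N. if y = xor x a then of_real (chi N b y) * W $$ (y,i) else 0)"
    using assms by (intro sum.cong refl) (auto simp: pauli_def)
  also have "\<dots> = of_real (chi N b (xor x a)) * W $$ (xor x a, i)"
    using assms by (simp add: sum.delta xor_less_exp)
  finally show ?thesis .
qed

lemma cadj_pauli_mult_index:
  assumes "W \<in> carrier_mat (2^N) K" "x < 2^N" "a < 2^N" "i < K"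
  shows "(cadj (pauli N a b) * W) $$ (x,i) = of_real (chi N b x) * W $$ (xor x a, i)"
proof -
  have "(cadj (pauli N a b) * W) $$ (x,i) = (\<Sum>y<2^N. cadj (pauli N a b) $$ (x,y) * W $$ (y,i))"
    by (rule mult_index[OF cadj_carrier[OF pauli_carrier] assms(1,2,4)])
  also have "\<dots> = (\<Sum>y<2^N. if y = xor x a then of_real (chi N b x) * W $$ (y,i) else 0)"
    using assms by (intro sum.cong refl) (auto simp: cadj_pauli_index)
  also have "\<dots> = of_real (chi N b x) * W $$ (xor x a, i)"
    using assms by (simp add: sum.delta xor_less_exp)
  finally show ?thesis .
qed

lemma is_channel_cadj_pauli:
  assumes "a < 2^N"
  shows "is_channel (2^N) (2^N) [cadj (pauli N a b)]"
  unfolding is_channel_iff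
proof (intro conjI ballI allI impI)
  fix i j :: nat assume ij: "i < 2^N" "j < 2^N"
  have "(\<Sum>r<2^N. cnj (cadj (pauli N a b) $$ (r,i)) * cadj (pauli N a b) $$ (r,j)) =
    (\<Sum>r<2^N. if r = xor i a then if i = j then 1 else 0 else 0)"
  proof (intro sum.cong refl)
    fix r :: nat assume "r \<in> {..<2^N}"
    then show "cnj (cadj (pauli N a b) $$ (r,i)) * cadj (pauli N a b) $$ (r,j) = (if r = xor i a then if i = j then 1 else 0 else 0)"
      using ij by (auto simp: cadj_pauli_index of_real_mult[symmetric] eq_xor_iff[of _ _ a] simp del: of_real_mult)
  qed
  also have "\<dots> = (if i = j then 1 else 0)" using assms ij by (simp add: sum.delta xor_less_exp)
  finally show "(\<Sum>K\<leftarrow>[cadj (pauli N a b)]. \<Sum>r<2^N. cnj (K $$ (r,i)) * K $$ (r,j)) = (if i = j then 1 else 0)" by simp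
qed auto

text \<open>Conjugation by \<open>pauli N c e\<close> multiplies \<open>pauli N a b\<close> by the
  sign \<open>chi N e a * chi N c b\<close>, so summing the conjugates of \<open>T\<close> with
  these signs projects onto that one component. Entrywise, the sum over \<open>e\<close> forces
  \<open>x = xor y a\<close> and the sum over \<open>c\<close> produces the coefficient.\<close>

lemma twirl_entry:
  assumes "x < 2^N" "y < 2^N" "a < 2^N" "b < 2^N"
  shows "(\<Sum>c<2^N. \<Sum>e<2^N. of_real (chi N e a * chi N c b) * (of_real (chi N e (xor x y)) * T $$ (xor x c, xor y c)))
    = (2^N)\<^sup>2 * (pauli_coeff N a b T * pauli N a b $$ (x,y))"
proof -
  have "(\<Sum>c<2^N. \<Sum>e<2^N. of_real (chi N e a * chi N c b) * (of_real (chi N e (xor x y)) * T $$ (xor x c, xor y c)))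
    = (\<Sum>c<2^N. of_real (chi N c b) * T $$ (xor x c, xor y c) * of_real (\<Sum>e<2^N. chi N (xor (xor x y) a) e))"
    by (simp add: chi_xor chi_xor_left chi_commute[of N _ a] chi_commute[of N _ x] chi_commute[of N _ y] sum_distrib_left mult_ac)
  also have "\<dots> = (\<Sum>c<2^N. of_real (chi N c b) * T $$ (xor x c, xor y c)) * (if x = xor y a then 2^N else 0)"
    using assms by (simp add: chi_sum xor_less_exp sum_distrib_right) (auto simp: eq_xor_iff[of x] xor.commute)
  also have "\<dots> = (2^N)\<^sup>2 * (pauli_coeff N a b T * pauli N a b $$ (x,y))"
  proof (cases "x = xor y a")
    case True
    have "(\<Sum>c<2^N. of_real (chi N c b) * T $$ (xor x c, xor y c)) =
      (\<Sum>c<2^N. of_real (chi N b y) * (of_real (chi N b (xor y c)) * T $$ (xor (xor y c) a, xor y c)))"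
    proof (intro sum.cong refl)
      fix c
      have "chi N b y * chi N b (xor y c) = chi N c b" by (simp add: chi_xor[symmetric] chi_commute)
      moreover have "xor (xor y c) a = xor x c" using True by (simp add: xor.assoc xor.commute xor.left_commute)
      ultimately show "of_real (chi N c b) * T $$ (xor x c, xor y c) = of_real (chi N b y) * (of_real (chi N b (xor y c)) * T $$ (xor (xor y c) a, xor y c))"
        by (metis mult.assoc of_real_mult)
    qed
    also have "\<dots> = of_real (chi N b y) * (\<Sum>z<2^N. of_real (chi N b z) * T $$ (xor z a, z))"
      unfolding sum_distrib_left[symmetric] using assms
      by (subst sum_xor_shift[where f="\<lambda>z. of_real (chi N b z) * T $$ (xor z a, z)"]) (auto simp: xor_less_exp)
    finally show ?thesis using True assms
      by (simp add: pauli_coeff_def pauli_def power2_eq_square)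
  next
    case False
    then show ?thesis using assms by (simp add: pauli_def)
  qed
  finally show ?thesis .
qed

lemma mtrace_sandwich:
  assumes "D \<in> carrier_mat K m" "X \<in> carrier_mat m m" "W \<in> carrier_mat m K"
  shows "mtrace (D * X * W) = (\<Sum>x<m. \<Sum>y<m. X $$ (x,y) * (\<Sum>i<K. D $$ (i,x) * W $$ (y,i)))"
proof -
  have "mtrace (D * X * W) = (\<Sum>i<K. \<Sum>y<m. (\<Sum>x<m. D $$ (i,x) * X $$ (x,y)) * W $$ (y,i))"
    by (simp add: mtrace_eq[OF mult_carrier_mat[OF mult_carrier_mat[OF assms(1,2)] assms(3)]]
      mult_index[OF mult_carrier_mat[OF assms(1,2)] assms(3)] mult_index[OF assms(1,2)])
  also have "\<dots> = (\<Sum>i<K. \<Sum>x<m. \<Sum>y<m. X $$ (x,y) * (D $$ (i,x) * W $$ (y,i)))"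
    unfolding sum_distrib_right by (rule sum.cong[OF refl], subst sum.swap) (simp add: mult_ac)
  also have "\<dots> = (\<Sum>x<m. \<Sum>y<m. X $$ (x,y) * (\<Sum>i<K. D $$ (i,x) * W $$ (y,i)))"
    by (simp add: sum_distrib_left sum.swap[of _ "{..<m}" "{..<K}"])
  finally show ?thesis .
qed

text \<open>Jensen's inequality for the average over \<open>(c,e)\<close>, weighted by the character that singles out the
  component of \<open>T\<close> along \<open>pauli N a b\<close>.\<close>

lemma pauli_twirl_bound:
  assumes D: "D \<in> carrier_mat K (2^N)" and T: "T \<in> carrier_mat (2^N) (2^N)" and W: "W \<in> carrier_mat (2^N) K"
    and ab: "a < 2^N" "b < 2^N"
  shows "(2^N)\<^sup>2 * ((cmod (pauli_coeff N a b T))\<^sup>2 * (cmod (mtrace (D * pauli N a b * W)))\<^sup>2)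
    \<le> (\<Sum>c<2^N. \<Sum>e<2^N. (cmod (mtrace (D * cadj (pauli N c e) * T * (pauli N c e * W))))\<^sup>2)"
proof -
  define w where "w x y = (\<Sum>i<K. D $$ (i,x) * W $$ (y,i))" for x y
  define z where "z c e = mtrace (D * cadj (pauli N c e) * T * (pauli N c e * W))" for c e
  have z: "z c e = (\<Sum>x<2^N. \<Sum>y<2^N. of_real (chi N e (xor x y)) * T $$ (xor x c, xor y c) * w x y)" if "c < 2^N" for c e
  proof -
    let ?P = "pauli N c e"
    have Pc: "cadj ?P \<in> carrier_mat (2^N) (2^N)" and P: "?P \<in> carrier_mat (2^N) (2^N)" by auto
    have 1: "D * cadj ?P * T * (?P * W) = D * (cadj ?P * T * ?P) * W"
      by (simp only: assoc_mult_mat[OF mult_carrier_mat[OF D mult_carrier_mat[OF Pc T]] P W, symmetric]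
        assoc_mult_mat[OF D Pc T] assoc_mult_mat[OF D mult_carrier_mat[OF Pc T] P])
    have X: "cadj ?P * T * ?P \<in> carrier_mat (2^N) (2^N)"
      by (rule mult_carrier_mat[OF mult_carrier_mat[OF Pc T] P])
    have "(cadj ?P * T * ?P) $$ (x,y) = of_real (chi N e (xor x y)) * T $$ (xor x c, xor y c)" if xy: "x < 2^N" "y < 2^N" for x y
    proof -
      have "(cadj ?P * T * ?P) $$ (x,y) = (\<Sum>s<2^N. (cadj ?P * T) $$ (x,s) * ?P $$ (s,y))"
        by (rule mult_index[OF mult_carrier_mat[OF Pc T] P xy])
      also have "\<dots> = (\<Sum>s<2^N. if s = xor y c then of_real (chi N e x) * T $$ (xor x c, s) * of_real (chi N e y) else 0)"
      proof (intro sum.cong refl)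
        fix s :: nat assume "s \<in> {..<2^N}"
        then show "(cadj ?P * T) $$ (x,s) * ?P $$ (s,y) = (if s = xor y c then of_real (chi N e x) * T $$ (xor x c, s) * of_real (chi N e y) else 0)"
          using xy \<open>c < 2^N\<close> eq_xor_iff[of s y c] by (simp add: cadj_pauli_mult_index[OF T] pauli_index)
      qed
      also have "\<dots> = of_real (chi N e (xor x y)) * T $$ (xor x c, xor y c)"
        using xy \<open>c < 2^N\<close> by (simp add: sum.delta xor_less_exp chi_xor)
      finally show ?thesis .
    qed
    then show ?thesis unfolding z_def 1 mtrace_sandwich[OF D X W] w_def by simp
  qed
  have "(\<Sum>c<2^N. \<Sum>e<2^N. of_real (chi N e a * chi N c b) * z c e) =
    (\<Sum>c<2^N. \<Sum>e<2^N. \<Sum>x<2^N. \<Sum>y<2^N. of_real (chi N e a * chi N c b) * (of_real (chi N e (xor x y)) * T $$ (xor x c, xor y c)) * w x y)"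
    by (intro sum.cong refl) (simp add: z sum_distrib_left mult_ac)
  also have "\<dots> = (\<Sum>x<2^N. \<Sum>y<2^N. \<Sum>c<2^N. \<Sum>e<2^N. of_real (chi N e a * chi N c b) * (of_real (chi N e (xor x y)) * T $$ (xor x c, xor y c)) * w x y)"
    (is "(\<Sum>c<_. \<Sum>e<_. \<Sum>x<_. \<Sum>y<_. ?F c e x y) = _")
  proof -
    have "(\<Sum>c<2^N. \<Sum>e<2^N. \<Sum>x<2^N. \<Sum>y<2^N. ?F c e x y) = (\<Sum>c<2^N. \<Sum>x<2^N. \<Sum>e<2^N. \<Sum>y<2^N. ?F c e x y)"
      by (rule sum.cong[OF refl]) (rule sum.swap)
    also have "\<dots> = (\<Sum>c<2^N. \<Sum>x<2^N. \<Sum>y<2^N. \<Sum>e<2^N. ?F c e x y)"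
      by (rule sum.cong[OF refl], rule sum.cong[OF refl]) (rule sum.swap)
    also have "\<dots> = (\<Sum>x<2^N. \<Sum>c<2^N. \<Sum>y<2^N. \<Sum>e<2^N. ?F c e x y)" by (rule sum.swap)
    also have "\<dots> = (\<Sum>x<2^N. \<Sum>y<2^N. \<Sum>c<2^N. \<Sum>e<2^N. ?F c e x y)"
      by (rule sum.cong[OF refl]) (rule sum.swap)
    finally show ?thesis .
  qed
  also have "\<dots> = (\<Sum>x<2^N. \<Sum>y<2^N. (2^N)\<^sup>2 * (pauli_coeff N a b T * pauli N a b $$ (x,y)) * w x y)"
    by (intro sum.cong refl) (simp only: sum_distrib_right[symmetric] twirl_entry ab lessThan_iff)
  also have "\<dots> = (2^N)\<^sup>2 * (pauli_coeff N a b T * mtrace (D * pauli N a b * W))"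
    unfolding mtrace_sandwich[OF D pauli_carrier W] w_def[symmetric] by (simp add: sum_distrib_left mult_ac)
  finally have avg: "(\<Sum>c<2^N. \<Sum>e<2^N. of_real (chi N e a * chi N c b) * z c e) = (2^N)\<^sup>2 * (pauli_coeff N a b T * mtrace (D * pauli N a b * W))" .
  \<comment> \<open>Cauchy-Schwarz over 4^N pairs, with signs of modulus 1, uses up one of the two
    factors 4^N.\<close>
  have "((2^N)\<^sup>2)\<^sup>2 * ((cmod (pauli_coeff N a b T))\<^sup>2 * (cmod (mtrace (D * pauli N a b * W)))\<^sup>2)
     = (cmod (\<Sum>c<2^N. \<Sum>e<2^N. of_real (chi N e a * chi N c b) * z c e))\<^sup>2"
    unfolding avg by (simp add: norm_mult norm_power power_mult_distrib)
  also have "\<dots> = (cmod (\<Sum>(c,e)\<in>{..<2^N}\<times>{..<2^N}. of_real (chi N e a * chi N c b) * z c e))\<^sup>2"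
    by (simp add: sum.cartesian_product)
  also have "\<dots> \<le> real (card ({..<2^N::nat}\<times>{..<2^N::nat})) * (\<Sum>p\<in>{..<2^N}\<times>{..<2^N}. (cmod (case p of (c,e) \<Rightarrow> of_real (chi N e a * chi N c b) * z c e))\<^sup>2)"
    by (rule norm_sum_squared_le)
  also have "(\<Sum>p\<in>{..<2^N}\<times>{..<2^N}. (cmod (case p of (c,e) \<Rightarrow> of_real (chi N e a * chi N c b) * z c e))\<^sup>2)
      = (\<Sum>(c,e)\<in>{..<2^N}\<times>{..<2^N}. (cmod (z c e))\<^sup>2)"
  proof (intro sum.cong refl)
    fix p :: "nat \<times> nat"
    obtain c e where p: "p = (c,e)" by force
    have "\<bar>chi N e a * chi N c b\<bar> = 1" using chi_cases[of N e a] chi_cases[of N c b] by (auto simp: abs_mult)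
    then show "(cmod (case p of (c,e) \<Rightarrow> of_real (chi N e a * chi N c b) * z c e))\<^sup>2 = (case p of (c,e) \<Rightarrow> (cmod (z c e))\<^sup>2)"
      by (simp add: p norm_mult abs_mult[symmetric] del: of_real_mult)
  qed
  also have "real (card ({..<2^N::nat}\<times>{..<2^N::nat})) = (2^N)\<^sup>2" by (simp add: card_cartesian_product power2_eq_square)
  finally have "(2^N)\<^sup>2 * ((2^N)\<^sup>2 * ((cmod (pauli_coeff N a b T))\<^sup>2 * (cmod (mtrace (D * pauli N a b * W)))\<^sup>2))
    \<le> (2^N)\<^sup>2 * (\<Sum>c<2^N. \<Sum>e<2^N. (cmod (z c e))\<^sup>2)"
    by (simp add: sum.cartesian_product power2_eq_square[of "(2^N)\<^sup>2"] mult.assoc)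
  then show ?thesis unfolding z_def by (rule mult_left_le_imp_le) simp
qed

text \<open>\<open>Q\<close> is the identity minus the orthogonal projection onto the span of an
  orthonormal family, so Q^dagger Q = Q.\<close>

lemma complement_projection_idem:
  fixes v :: "'i \<Rightarrow> nat \<Rightarrow> complex" and m :: nat
  assumes fin: "finite I"
    and orth: "\<And>\<alpha> \<beta>. \<alpha> \<in> I \<Longrightarrow> \<beta> \<in> I \<Longrightarrow> (\<Sum>z<m. cnj (v \<alpha> z) * v \<beta> z) = (if \<alpha> = \<beta> then 1 else 0)"
    and xy: "x < m" "y < m"
  defines "Q \<equiv> \<lambda>x y. (if x = y then 1 else 0) - (\<Sum>\<alpha>\<in>I. v \<alpha> x * cnj (v \<alpha> y))"
  shows "(\<Sum>z<m. cnj (Q z x) * Q z y) = Q x y"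
proof -
  define P where "P x y = (\<Sum>\<alpha>\<in>I. v \<alpha> x * cnj (v \<alpha> y))" for x y
  have P1: "cnj (P z x) = P x z" for z x by (simp add: P_def mult.commute)
  have "(\<Sum>z<m. P x z * P z y) = (\<Sum>z<m. \<Sum>\<alpha>\<in>I. \<Sum>\<beta>\<in>I. v \<alpha> x * cnj (v \<beta> y) * (cnj (v \<alpha> z) * v \<beta> z))"
    unfolding P_def sum_product by (simp add: mult_ac)
  also have "\<dots> = (\<Sum>\<alpha>\<in>I. \<Sum>z<m. \<Sum>\<beta>\<in>I. v \<alpha> x * cnj (v \<beta> y) * (cnj (v \<alpha> z) * v \<beta> z))"
    by (rule sum.swap)
  also have "\<dots> = (\<Sum>\<alpha>\<in>I. \<Sum>\<beta>\<in>I. \<Sum>z<m. v \<alpha> x * cnj (v \<beta> y) * (cnj (v \<alpha> z) * v \<beta> z))"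
    by (rule sum.cong[OF refl], rule sum.swap)
  also have "\<dots> = (\<Sum>\<alpha>\<in>I. \<Sum>\<beta>\<in>I. if \<beta> = \<alpha> then v \<alpha> x * cnj (v \<beta> y) else 0)"
    by (intro sum.cong refl) (auto simp: sum_distrib_left[symmetric] orth)
  also have "\<dots> = P x y" using fin by (simp add: P_def sum.delta)
  finally have P2: "(\<Sum>z<m. P x z * P z y) = P x y" .
  have Q: "Q z w = (if z = w then 1 else 0) - P z w" for z w by (simp add: Q_def P_def)
  have "(\<Sum>z<m. cnj (Q z x) * Q z y) = (\<Sum>z<m. (if z = x then (if x = y then 1 else 0) - P z y else 0) - (if z = y then P x z else 0) + P x z * P z y)"
    by (intro sum.cong refl) (auto simp: Q P1 algebra_simps)
  also have "\<dots> = Q x y" using xy by (simp add: sum.distrib sum_subtractf sum.delta P2 Q)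
  finally show ?thesis .
qed

text \<open>The recovery inverts the isometries \<open>S p\<close>, whose ranges are mutually orthogonal, and sends the
  complement of their ranges to a fixed state.\<close>

lemma orthogonal_isometries_decoder:
  fixes S :: "'p \<Rightarrow> complex mat"
  assumes js: "distinct js" and K: "K \<ge> 1"
    and S: "\<And>p. p \<in> set js \<Longrightarrow> S p \<in> carrier_mat m K"
    and orth: "\<And>p p' i j. p \<in> set js \<Longrightarrow> p' \<in> set js \<Longrightarrow> i < K \<Longrightarrow> j < K \<Longrightarrow>
      (\<Sum>y<m. cnj (S p $$ (y,i)) * S p' $$ (y,j)) = (if i = j \<and> p = p' then 1 else 0)"
  shows "\<exists>Rs. is_channel m K (map (\<lambda>p. cadj (S p)) js @ Rs)"
proof -
  define v where "v = (\<lambda>(p,i) x. S p $$ (x,i))"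
  define I where "I = set js \<times> {..<K}"
  define Q where "Q = (\<lambda>x y. (if x = y then 1 else 0) - (\<Sum>\<alpha>\<in>I. v \<alpha> x * cnj (v \<alpha> y)))"
  \<comment> \<open>Basis vector 0 times row \<open>s\<close> of \<open>Q\<close>: over all
    \<open>s\<close> the products R^dagger R add up to Q^dagger Q = Q, exactly what the isometries
    leave of the identity.\<close>
  define R where "R s = mat K m (\<lambda>(r,c). if r = 0 then Q s c else 0)" for s
  have orth': "(\<Sum>z<m. cnj (v \<alpha> z) * v \<beta> z) = (if \<alpha> = \<beta> then 1 else 0)" if "\<alpha> \<in> I" "\<beta> \<in> I" for \<alpha> \<beta>
  proof -
    obtain p i p' j where "\<alpha> = (p,i)" "\<beta> = (p',j)" by force
    then show ?thesis using that orth[of p p' i j] by (auto simp: I_def v_def)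
  qed
  have "is_channel m K (map (\<lambda>p. cadj (S p)) js @ map R [0..<m])"
    unfolding is_channel_iff
  proof (intro conjI ballI allI impI)
    fix X assume "X \<in> set (map (\<lambda>p. cadj (S p)) js @ map R [0..<m])"
    then show "X \<in> carrier_mat K m" using S by (auto simp: R_def)
  next
    fix i j assume ij: "i < m" "j < m"
    have "(\<Sum>p\<leftarrow>js. \<Sum>r<K. cnj (cadj (S p) $$ (r,i)) * cadj (S p) $$ (r,j)) = (\<Sum>p\<leftarrow>js. \<Sum>r<K. v (p,r) i * cnj (v (p,r) j))"
      using ij S by (intro arg_cong[where f=sum_list] map_cong refl sum.cong) (auto simp: v_def cadj_index[OF S])
    also have "\<dots> = (\<Sum>\<alpha>\<in>I. v \<alpha> i * cnj (v \<alpha> j))"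
      by (simp add: I_def sum_list_distinct_conv_sum_set[OF js] sum.cartesian_product)
    finally have 1: "(\<Sum>p\<leftarrow>js. \<Sum>r<K. cnj (cadj (S p) $$ (r,i)) * cadj (S p) $$ (r,j)) = (\<Sum>\<alpha>\<in>I. v \<alpha> i * cnj (v \<alpha> j))" .
    have "(\<Sum>r<K. cnj (R s $$ (r,i)) * R s $$ (r,j)) = cnj (Q s i) * Q s j" for s
    proof -
      have "(\<Sum>r<K. cnj (R s $$ (r,i)) * R s $$ (r,j)) = (\<Sum>r<K. if r = 0 then cnj (Q s i) * Q s j else 0)"
        using ij by (intro sum.cong refl) (auto simp: R_def)
      then show ?thesis using K by (simp add: sum.delta)
    qed
    then have "(\<Sum>s\<leftarrow>[0..<m]. \<Sum>r<K. cnj (R s $$ (r,i)) * R s $$ (r,j)) = (\<Sum>s<m. cnj (Q s i) * Q s j)"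
      by (simp add: interv_sum_list_conv_sum_set_nat lessThan_atLeast0)
    also have "\<dots> = Q i j"
      unfolding Q_def by (rule complement_projection_idem[OF _ orth' ij]) (auto simp: I_def)
    finally show "(\<Sum>X\<leftarrow>map (\<lambda>p. cadj (S p)) js @ map R [0..<m]. \<Sum>r<K. cnj (X $$ (r,i)) * X $$ (r,j)) = (if i = j then 1 else 0)"
      using 1 by (simp add: o_def Q_def)
  qed
  then show ?thesis by blast
qed

text \<open>Decoder branch (a,b) undoes \<open>pauli N a b\<close> exactly: its trace is tr(S^dagger
  S) = K. By \<open>pauli_twirl_bound\<close> the conjugated codes have on average at least the
  fidelity given by the coefficients in \<open>J\<close>, and some conjugate reaches the average.
  The isometry hypothesis ranges over all Paulis, not just \<open>J\<close>, because the conjugating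
  one is arbitrary.\<close>

lemma twirled_code:
  assumes V: "V \<in> carrier_mat (2^N) K" and K: "K \<ge> 1"
    and T: "\<And>T. T \<in> set Ts \<Longrightarrow> T \<in> carrier_mat (2^N) (2^N)"
    and J: "J \<subseteq> {..<2^N} \<times> {..<2^N}"
    and iso: "\<And>a b i j. a < 2^N \<Longrightarrow> b < 2^N \<Longrightarrow> i < K \<Longrightarrow> j < K \<Longrightarrow>
      (\<Sum>y<2^N. cnj ((pauli N a b * V) $$ (y,i)) * (pauli N a b * V) $$ (y,j)) = (if i = j then 1 else 0)"
    and orth: "\<And>a b a' b' i j. (a,b) \<in> J \<Longrightarrow> (a',b') \<in> J \<Longrightarrow> i < K \<Longrightarrow> j < K \<Longrightarrow>
      (\<Sum>y<2^N. cnj ((pauli N a b * V) $$ (y,i)) * (pauli N a' b' * V) $$ (y,j))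
        = (if i = j \<and> (a,b) = (a',b') then 1 else 0)"
  shows "\<exists>Es Ds. is_channel K (2^N) Es \<and> is_channel (2^N) K Ds \<and>
    (\<Sum>(a,b)\<in>J. \<Sum>T\<leftarrow>Ts. (cmod (pauli_coeff N a b T))\<^sup>2) \<le>
    (\<Sum>D\<leftarrow>Ds. \<Sum>T\<leftarrow>Ts. \<Sum>E\<leftarrow>Es. (cmod (mtrace (D * T * E)))\<^sup>2) / (real K)\<^sup>2"
proof -
  define S where "S = (\<lambda>(a,b). pauli N a b * V)"
  have finJ: "finite J" using J finite_subset by blast
  then obtain js where js: "set js = J" "distinct js" using finite_distinct_list by blast
  have Sc: "S p \<in> carrier_mat (2^N) K" for p
    using mult_carrier_mat[OF pauli_carrier V] by (auto simp: S_def split: prod.split)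
  obtain Rs where Rs: "is_channel (2^N) K (map (\<lambda>p. cadj (S p)) js @ Rs)"
    using orthogonal_isometries_decoder[OF js(2) K Sc] orth unfolding js(1) S_def by fastforce
  define Ds0 where "Ds0 = map (\<lambda>p. cadj (S p)) js @ Rs"
  define Dg where "Dg c e = [D * P. D \<leftarrow> Ds0, P \<leftarrow> [cadj (pauli N c e)]]" for c e
  define Eg where "Eg c e = [pauli N c e * V]" for c e
  define tot where "tot c e = (\<Sum>D\<leftarrow>Dg c e. \<Sum>T\<leftarrow>Ts. \<Sum>E\<leftarrow>Eg c e. (cmod (mtrace (D * T * E)))\<^sup>2)" for c e
  define G where "G = (\<Sum>(a,b)\<in>J. \<Sum>T\<leftarrow>Ts. (cmod (pauli_coeff N a b T))\<^sup>2)"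
  have D: "is_channel (2^N) K (Dg c e)" if "c < 2^N" for c e
    unfolding Dg_def by (rule is_channel_compose[OF Rs[folded Ds0_def] is_channel_cadj_pauli[OF that]])
  have E: "is_channel K (2^N) (Eg c e)" if "c < 2^N" "e < 2^N" for c e
    using iso[OF that] mult_carrier_mat[OF pauli_carrier V] by (auto simp: is_channel_iff Eg_def)
  have trS: "mtrace (cadj (S (a,b)) * pauli N a b * V) = of_nat K" if "(a,b) \<in> J" for a b
  proof -
    have c: "cadj (S (a,b)) \<in> carrier_mat K (2^N)" using Sc by auto
    have "cadj (S (a,b)) * pauli N a b * V = cadj (S (a,b)) * S (a,b)"
      unfolding S_def using assoc_mult_mat[OF c pauli_carrier V] by (simp add: S_def)
    also have "mtrace \<dots> = (\<Sum>i<K. \<Sum>y<2^N. cnj (S (a,b) $$ (y,i)) * S (a,b) $$ (y,i))"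
      by (simp add: mtrace_eq[OF mult_carrier_mat[OF c Sc]] mult_index[OF c Sc] cadj_index[OF Sc])
    also have "\<dots> = of_nat K" using orth[OF that that] by (simp add: S_def)
    finally show ?thesis .
  qed
  have lower: "(\<Sum>p\<in>J. \<Sum>T\<leftarrow>Ts. (cmod (mtrace (cadj (S p) * cadj (pauli N c e) * T * (pauli N c e * V))))\<^sup>2) \<le> tot c e" for c e
    by (auto simp: tot_def Dg_def Eg_def Ds0_def sum_list_concat_map o_def sum_list_distinct_conv_sum_set[OF js(2)] js(1)
      intro!: sum_list_nonneg)
  have "(2^N)\<^sup>2 * (G * (real K)\<^sup>2) = (\<Sum>(a,b)\<in>J. \<Sum>T\<leftarrow>Ts. (2^N)\<^sup>2 * ((cmod (pauli_coeff N a b T))\<^sup>2 * (real K)\<^sup>2))"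
    by (simp add: G_def sum_list_mult_pull sum_distrib_left sum_distrib_right case_prod_beta)
  also have "\<dots> \<le> (\<Sum>p\<in>J. \<Sum>T\<leftarrow>Ts. \<Sum>c<2^N. \<Sum>e<2^N. (cmod (mtrace (cadj (S p) * cadj (pauli N c e) * T * (pauli N c e * V))))\<^sup>2)"
  proof (rule sum_mono)
    fix p assume p: "p \<in> J"
    obtain a b where ab: "p = (a,b)" by force
    have c: "cadj (S p) \<in> carrier_mat K (2^N)" using Sc by auto
    have "(2^N)\<^sup>2 * ((cmod (pauli_coeff N a b T))\<^sup>2 * (real K)\<^sup>2) \<le> (\<Sum>c<2^N. \<Sum>e<2^N. (cmod (mtrace (cadj (S p) * cadj (pauli N c e) * T * (pauli N c e * V))))\<^sup>2)"
      if t: "T \<in> set Ts" for T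
    proof -
      have "a < 2^N" "b < 2^N" using p J ab by auto
      from pauli_twirl_bound[OF c T[OF t] V this] show ?thesis
        using trS p by (simp add: ab)
    qed
    then show "(case p of (a,b) \<Rightarrow> \<Sum>T\<leftarrow>Ts. (2^N)\<^sup>2 * ((cmod (pauli_coeff N a b T))\<^sup>2 * (real K)\<^sup>2)) \<le>
       (\<Sum>T\<leftarrow>Ts. \<Sum>c<2^N. \<Sum>e<2^N. (cmod (mtrace (cadj (S p) * cadj (pauli N c e) * T * (pauli N c e * V))))\<^sup>2)"
      unfolding ab by (auto intro!: sum_list_mono)
  qed
  also have "\<dots> = (\<Sum>c<2^N. \<Sum>e<2^N. \<Sum>p\<in>J. \<Sum>T\<leftarrow>Ts. (cmod (mtrace (cadj (S p) * cadj (pauli N c e) * T * (pauli N c e * V))))\<^sup>2)"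
    by (simp only: sum_list_sum_swap sum.swap[where A=J and B="{..<2^N}"])
  also have "\<dots> \<le> (\<Sum>c<2^N. \<Sum>e<2^N. tot c e)" by (intro sum_mono lower)
  finally have avg: "(2^N)\<^sup>2 * (G * (real K)\<^sup>2) \<le> (\<Sum>c<2^N. \<Sum>e<2^N. tot c e)" .
  have "\<exists>c<2^N. \<exists>e<2^N. G * (real K)\<^sup>2 \<le> tot c e"
  proof (rule ccontr)
    assume "\<not> ?thesis"
    then have "(\<Sum>c<2^N. \<Sum>e<2^N. tot c e) < (\<Sum>c<(2::nat)^N. \<Sum>e<(2::nat)^N. G * (real K)\<^sup>2)"
      by (intro sum_strict_mono) (auto simp: not_le lessThan_empty_iff)
    then show False using avg by (simp add: power2_eq_square)
  qed
  then obtain c e where ce: "c < 2^N" "e < 2^N" "G * (real K)\<^sup>2 \<le> tot c e" by blast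
  then have "G \<le> tot c e / (real K)\<^sup>2" using K by (simp add: le_divide_eq)
  then show ?thesis using D[OF ce(1)] E[OF ce(1,2)] unfolding G_def tot_def by blast
qed

section \<open>Weights of Pauli errors in a tensor power\<close>

text \<open>The number of the \<open>m\<close> base-\<open>q\<close> digit positions at which \<open>a\<close> or \<open>b\<close> is nonzero.\<close>

fun wt :: "nat \<Rightarrow> nat \<Rightarrow> nat \<Rightarrow> nat \<Rightarrow> nat" where
  "wt q 0 a b = 0"
| "wt q (Suc m) a b = (if a div q^m = 0 \<and> b div q^m = 0 then 0 else 1) + wt q m (a mod q^m) (b mod q^m)"

lemma wt_0 [simp]: "wt q m 0 0 = 0"
  by (induction m) auto

text \<open>The outer code treats bit and phase parts separately; each inherits the bound on the
  joint weight.\<close>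

lemma wt_le_joint: "wt q m a 0 \<le> wt q m a b" "wt q m b 0 \<le> wt q m a b"
proof (induction m arbitrary: a b)
  case (Suc m)
  { case 1 show ?case using Suc(1)[of "a mod q^m" "b mod q^m"] by auto }
  { case 2 show ?case using Suc(2)[of "b mod q^m" "a mod q^m"] by auto }
qed auto

lemma xor_div_exp: "xor a b div 2^n = xor (a div 2^n) (b div 2^n :: nat)"
  by (metis drop_bit_eq_div drop_bit_xor)

lemma xor_mod_exp: "xor a b mod 2^n = xor (a mod 2^n) (b mod 2^n :: nat)"
  by (metis take_bit_eq_mod take_bit_xor)

lemma wt_xor_le: "wt (2^l) m (xor a b) 0 \<le> wt (2^l) m a 0 + wt (2^l) m b 0"
proof (induction m arbitrary: a b)
  case (Suc m)
  have "wt (2^l) m (xor a b mod (2^l)^m) 0 \<le> wt (2^l) m (a mod (2^l)^m) 0 + wt (2^l) m (b mod (2^l)^m) 0"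
    using Suc[of "a mod (2^l)^m" "b mod (2^l)^m"] by (simp add: power_mult[symmetric] xor_mod_exp)
  moreover have "a div (2^l)^m = 0 \<Longrightarrow> b div (2^l)^m = 0 \<Longrightarrow> xor a b div (2^l)^m = 0"
    by (simp only: power_mult[symmetric] xor_div_exp) simp
  ultimately show ?case by auto
qed simp

text \<open>The weight enumerator at 1/q factors over the digits, and each digit contributes 1 + (q
  - 1)/q \<le> 2.\<close>

lemma sum_inverse_power_wt:
  assumes "q \<ge> 1"
  shows "(\<Sum>a<q^m. (1 / real q) ^ wt q m a 0) \<le> 2^m"
proof (induction m)
  case (Suc m)
  have "(\<Sum>a<q^Suc m. (1 / real q) ^ wt q (Suc m) a 0) = (\<Sum>a<q. \<Sum>a'<q^m. (1 / real q) ^ wt q (Suc m) (a*q^m+a') 0)"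
    unfolding power_Suc by (rule sum_lessThan_mult)
  also have "\<dots> = (\<Sum>a<q. \<Sum>a'<q^m. (if a = 0 then 1 else 1 / real q) * (1 / real q) ^ wt q m a' 0)"
    by (intro sum.cong refl) auto
  also have "\<dots> = (\<Sum>a<q. if a = 0 then 1 else 1 / real q) * (\<Sum>a'<q^m. (1 / real q) ^ wt q m a' 0)"
    by (simp add: sum_product)
  also have "\<dots> \<le> 2 * 2^m"
  proof (intro mult_mono Suc sum_nonneg)
    have "(\<Sum>a<q. if a = 0 then 1 else 1 / real q) \<le> (\<Sum>a<q. (if a = 0 then 1 else 0) + 1 / real q)"
      by (intro sum_mono) auto
    also have "\<dots> \<le> 2" using assms by (simp add: sum.distrib sum.delta)
    finally show "(\<Sum>a<q. if a = 0 then 1 else 1 / real q) \<le> 2" .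
  qed auto
  finally show ?case by simp
qed simp

text \<open>Every counted string contributes at least q^(-s) to the enumerator at 1/q; this avoids
  estimates of binomial coefficients.\<close>

lemma card_wt_le:
  assumes "q \<ge> 1"
  shows "card {a. a < q^m \<and> wt q m a 0 \<le> s} \<le> 2^m * q^s"
proof -
  let ?A = "{a. a < q^m \<and> wt q m a 0 \<le> s}"
  have "real (card ?A) * (1 / real q)^s = (\<Sum>a\<in>?A. (1 / real q)^s)" by simp
  also have "\<dots> \<le> (\<Sum>a\<in>?A. (1 / real q) ^ wt q m a 0)"
    using assms by (intro sum_mono power_decreasing) auto
  also have "\<dots> \<le> (\<Sum>a<q^m. (1 / real q) ^ wt q m a 0)" by (intro sum_mono2) auto
  also have "\<dots> \<le> 2^m" by (rule sum_inverse_power_wt[OF assms])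
  finally have "real (card ?A) \<le> 2^m * real q^s" using assms by (simp add: power_one_over field_simps)
  then have "real (card ?A) \<le> real (2^m * q^s)" by simp
  then show ?thesis using of_nat_le_iff by blast
qed

section \<open>Pauli coefficients of tensor products and the error distribution they define\<close>

lemma chi_add:
  "chi (N + l) b z = chi N (b mod 2^N) (z mod 2^N) * chi l (b div 2^N) (z div 2^N)"
proof (induction l)
  case 0
  show ?case by (auto simp: chi_def take_bit_eq_mod[symmetric] bit_take_bit_iff intro!: prod.cong)
next
  case (Suc l)
  have "chi (N + Suc l) b z = chi (N + l) b z * (if bit b (N+l) \<and> bit z (N+l) then -1 else 1)"
    by (simp add: chi_def)
  moreover have "chi (Suc l) (b div 2^N) (z div 2^N) = chi l (b div 2^N) (z div 2^N) * (if bit b (N+l) \<and> bit z (N+l) then -1 else 1)"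
    by (simp add: chi_def drop_bit_eq_div[symmetric] bit_drop_bit_eq)
  ultimately show ?case using Suc by simp
qed

text \<open>Indices of a Kronecker product split by \<open>div\<close> and \<open>mod\<close> 2^N,
  and both \<open>xor\<close> and the characters respect this split; the left factor holds the high
  bits.\<close>

lemma pauli_coeff_kron:
  assumes B: "B \<in> carrier_mat (2^l) (2^l)" and T: "T \<in> carrier_mat (2^N) (2^N)" and a: "a < 2^(N+l)"
  shows "pauli_coeff (N+l) a b (kron B T) =
    pauli_coeff l (a div 2^N) (b div 2^N) B * pauli_coeff N (a mod 2^N) (b mod 2^N) T"
proof -
  have ad: "a div 2^N < 2^l" using a by (intro less_mult_imp_div_less) (simp add: power_add mult.commute)
  have "(\<Sum>z<2^(N+l). of_real (chi (N+l) b z) * kron B T $$ (xor z a, z)) =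
    (\<Sum>z<2^l * 2^N. of_real (chi (N+l) b z) * kron B T $$ (xor z a, z))" by (simp add: power_add mult.commute)
  also have "\<dots> = (\<Sum>i<2^l. \<Sum>j<2^N. of_real (chi (N+l) b (i*2^N+j)) * kron B T $$ (xor (i*2^N+j) a, i*2^N+j))"
    by (rule sum_lessThan_mult)
  also have "\<dots> = (\<Sum>i<2^l. \<Sum>j<2^N. (of_real (chi l (b div 2^N) i) * B $$ (xor i (a div 2^N), i)) *
     (of_real (chi N (b mod 2^N) j) * T $$ (xor j (a mod 2^N), j)))"
  proof (intro sum.cong refl)
    fix i j :: nat assume ij: "i \<in> {..<2^l}" "j \<in> {..<2^N}"
    then have lt: "i*2^N+j < 2^l*2^N" by (intro mult_add_less) auto
    then have "xor (i*2^N+j) a < 2^(N+l)" using a by (intro xor_less_exp) (auto simp: power_add mult.commute)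
    then have "xor (i*2^N+j) a < 2^l*2^N" by (simp add: power_add mult.commute)
    from kron_index'[OF B T this lt]
    have "kron B T $$ (xor (i*2^N+j) a, i*2^N+j) = B $$ (xor i (a div 2^N), i) * T $$ (xor j (a mod 2^N), j)"
      using ij by (simp add: xor_div_exp xor_mod_exp)
    moreover have "chi (N+l) b (i*2^N+j) = chi N (b mod 2^N) j * chi l (b div 2^N) i"
      using ij by (simp add: chi_add)
    ultimately show "of_real (chi (N+l) b (i*2^N+j)) * kron B T $$ (xor (i*2^N+j) a, i*2^N+j) =
      (of_real (chi l (b div 2^N) i) * B $$ (xor i (a div 2^N), i)) * (of_real (chi N (b mod 2^N) j) * T $$ (xor j (a mod 2^N), j))"
      by simp
  qed
  also have "\<dots> = (\<Sum>i<2^l. of_real (chi l (b div 2^N) i) * B $$ (xor i (a div 2^N), i)) *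
     (\<Sum>j<2^N. of_real (chi N (b mod 2^N) j) * T $$ (xor j (a mod 2^N), j))"
    by (simp add: sum_product)
  finally show ?thesis by (simp add: pauli_coeff_def power_add)
qed

lemma chi_parseval:
  fixes h :: "nat \<Rightarrow> complex"
  shows "(\<Sum>b<2^N. (cmod (\<Sum>z<2^N. of_real (chi N b z) * h z))\<^sup>2) = 2^N * (\<Sum>z<2^N. (cmod (h z))\<^sup>2)"
proof -
  have "complex_of_real (\<Sum>b<2^N. (cmod (\<Sum>z<2^N. of_real (chi N b z) * h z))\<^sup>2) =
    (\<Sum>b<2^N. \<Sum>z<2^N. \<Sum>y<2^N. of_real (chi N b (xor z y)) * (h z * cnj (h y)))"
    unfolding of_real_sum complex_norm_square cnj_sum sum_product by (simp add: chi_xor mult_ac)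
  also have "\<dots> = (\<Sum>z<2^N. \<Sum>b<2^N. \<Sum>y<2^N. of_real (chi N b (xor z y)) * (h z * cnj (h y)))"
    by (rule sum.swap)
  also have "\<dots> = (\<Sum>z<2^N. \<Sum>y<2^N. \<Sum>b<2^N. of_real (chi N b (xor z y)) * (h z * cnj (h y)))"
    by (rule sum.cong[OF refl], rule sum.swap)
  also have "\<dots> = (\<Sum>z<2^N. \<Sum>y<2^N. of_real (\<Sum>b<2^N. chi N (xor z y) b) * (h z * cnj (h y)))"
    by (simp add: sum_distrib_right chi_commute)
  also have "\<dots> = (\<Sum>z<2^N. \<Sum>y<2^N. if y = z then 2^N * (h z * cnj (h y)) else 0)"
  proof (intro sum.cong refl)
    fix y z :: nat assume "z \<in> {..<2^N}" "y \<in> {..<2^N}"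
    then have "xor z y < 2^N" by (auto intro: xor_less_exp)
    from chi_sum[OF this] show "of_real (\<Sum>b<2^N. chi N (xor z y) b) * (h z * cnj (h y)) = (if y = z then 2^N * (h z * cnj (h y)) else 0)"
      by auto
  qed
  also have "\<dots> = 2^N * (\<Sum>z<2^N. complex_of_real ((cmod (h z))\<^sup>2))"
    unfolding complex_norm_square by (simp add: sum.delta sum_distrib_left)
  also have "\<dots> = complex_of_real (2^N * (\<Sum>z<2^N. (cmod (h z))\<^sup>2))" by simp
  finally show ?thesis using of_real_eq_iff by blast
qed

text \<open>For fixed \<open>a\<close> the coefficients are, up to 2^N, the Walsh-Hadamard transform
  of the entries at (xor z a, z); as \<open>a\<close> varies, these run through the whole
  matrix.\<close>

lemma pauli_coeff_parseval:
  "(\<Sum>a<2^N. \<Sum>b<2^N. (cmod (pauli_coeff N a b T))\<^sup>2) = (\<Sum>y<2^N. \<Sum>x<2^N. (cmod (T $$ (x,y)))\<^sup>2) / 2^N"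
proof -
  have "(\<Sum>b<2^N. (cmod (pauli_coeff N a b T))\<^sup>2) = (\<Sum>z<2^N. (cmod (T $$ (xor z a, z)))\<^sup>2) / 2^N" for a
  proof -
    have "(\<Sum>b<2^N. (cmod (pauli_coeff N a b T))\<^sup>2) = (\<Sum>b<2^N. (cmod (\<Sum>z<2^N. of_real (chi N b z) * T $$ (xor z a, z)))\<^sup>2) / (2^N)\<^sup>2"
      unfolding sum_divide_distrib
      by (intro sum.cong refl) (simp add: pauli_coeff_def norm_divide norm_power power_divide)
    then show ?thesis unfolding chi_parseval by (simp add: power2_eq_square[of "2^N"])
  qed
  then have "(\<Sum>a<2^N. \<Sum>b<2^N. (cmod (pauli_coeff N a b T))\<^sup>2) = (\<Sum>a<2^N. \<Sum>z<2^N. (cmod (T $$ (xor z a, z)))\<^sup>2) / 2^N"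
    by (simp add: sum_divide_distrib)
  also have "(\<Sum>a<2^N. \<Sum>z<2^N. (cmod (T $$ (xor z a, z)))\<^sup>2) = (\<Sum>z<2^N. \<Sum>a<2^N. (cmod (T $$ (xor z a, z)))\<^sup>2)"
    by (rule sum.swap)
  also have "\<dots> = (\<Sum>z<2^N. \<Sum>x<2^N. (cmod (T $$ (x, z)))\<^sup>2)"
    by (intro sum.cong refl sum_xor_shift) (auto simp: xor_less_exp)
  finally show ?thesis .
qed

text \<open>The probability of the error \<open>X^a Z^b\<close> in the Pauli twirl of a
  channel.\<close>

definition pauli_prob :: "nat \<Rightarrow> complex mat list \<Rightarrow> nat \<Rightarrow> nat \<Rightarrow> real" where
  "pauli_prob N Ts a b = (\<Sum>T\<leftarrow>Ts. (cmod (pauli_coeff N a b T))\<^sup>2)"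

lemma pauli_prob_nonneg: "pauli_prob N Ts a b \<ge> 0"
  unfolding pauli_prob_def by (intro sum_list_nonneg) auto

lemma sum_pauli_prob:
  assumes "is_channel (2^N) (2^N) Ts"
  shows "(\<Sum>a<2^N. \<Sum>b<2^N. pauli_prob N Ts a b) = 1"
proof -
  have "(\<Sum>a<2^N. \<Sum>b<2^N. pauli_prob N Ts a b) = (\<Sum>T\<leftarrow>Ts. \<Sum>a<2^N. \<Sum>b<2^N. (cmod (pauli_coeff N a b T))\<^sup>2)"
    by (simp only: pauli_prob_def sum_list_sum_swap)
  also have "\<dots> = (\<Sum>T\<leftarrow>Ts. (\<Sum>y<2^N. \<Sum>x<2^N. (cmod (T $$ (x,y)))\<^sup>2) * (1 / 2^N))"
    by (simp add: pauli_coeff_parseval)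
  also have "\<dots> = (\<Sum>y<2^N. \<Sum>T\<leftarrow>Ts. \<Sum>x<2^N. (cmod (T $$ (x,y)))\<^sup>2) * (1 / 2^N)"
    by (simp only: sum_list_mult_pull sum_list_sum_swap[of _ "{..<2^N}" Ts])
  also have "\<dots> = (\<Sum>y<(2::nat)^N. 1) * (1 / 2^N)"
    using is_channel_norm[OF assms] by simp
  finally show ?thesis by simp
qed

text \<open>The coefficient along the identity is the normalised trace. This is where the quality of
  the inner code enters: no error on a block has the inner fidelity as its probability.\<close>

lemma pauli_prob_0:
  assumes "\<And>B. B \<in> set Bs \<Longrightarrow> B \<in> carrier_mat (2^l) (2^l)"
  shows "pauli_prob l Bs 0 0 = ent_fid_maxmixed (2^l) Bs"
proof -
  have "pauli_prob l Bs 0 0 = (\<Sum>B\<leftarrow>Bs. (cmod (mtrace B))\<^sup>2 * (1 / (2^l)\<^sup>2))"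
    unfolding pauli_prob_def using assms
    by (intro arg_cong[where f=sum_list] map_cong refl)
       (simp add: pauli_coeff_def mtrace_eq[OF assms] norm_divide norm_power power_divide)
  then show ?thesis by (simp only: ent_fid_maxmixed_eq[OF assms] sum_list_mult_pull) simp
qed

lemma pauli_prob_tpow_Suc:
  assumes B: "\<And>B. B \<in> set Bs \<Longrightarrow> B \<in> carrier_mat (2^l) (2^l)" and a: "a < 2^(m*l+l)"
  shows "pauli_prob (m*l+l) (kraus_tpow Bs (Suc m)) a b =
    pauli_prob l Bs (a div 2^(m*l)) (b div 2^(m*l)) * pauli_prob (m*l) (kraus_tpow Bs m) (a mod 2^(m*l)) (b mod 2^(m*l))"
proof -
  have c: "T \<in> carrier_mat (2^(m*l)) (2^(m*l))" if "T \<in> set (kraus_tpow Bs m)" for T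
    using tpow_carrier[of Bs, OF B that] by (simp add: power_mult[symmetric] mult.commute)
  have "pauli_prob (m*l+l) (kraus_tpow Bs (Suc m)) a b =
    (\<Sum>B\<leftarrow>Bs. \<Sum>T\<leftarrow>kraus_tpow Bs m. (cmod (pauli_coeff (m*l+l) a b (kron B T)))\<^sup>2)"
    by (simp add: pauli_prob_def sum_list_concat_map o_def)
  also have "\<dots> = (\<Sum>B\<leftarrow>Bs. \<Sum>T\<leftarrow>kraus_tpow Bs m. (cmod (pauli_coeff l (a div 2^(m*l)) (b div 2^(m*l)) B))\<^sup>2 *
     (cmod (pauli_coeff (m*l) (a mod 2^(m*l)) (b mod 2^(m*l)) T))\<^sup>2)"
    using B c a
    by (intro arg_cong[where f=sum_list] map_cong refl) (simp add: pauli_coeff_kron norm_mult power_mult_distrib)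
  finally show ?thesis by (simp add: pauli_prob_def sum_list_mult_pull)
qed

text \<open>The error distribution of the power is a product over blocks and the weight is a sum
  over blocks, so the generating function of the weight is an m-th power.\<close>

lemma wt_generating_function:
  fixes x :: real
  assumes B: "\<And>B. B \<in> set Bs \<Longrightarrow> B \<in> carrier_mat (2^l) (2^l)"
  shows "(\<Sum>a<2^(m*l). \<Sum>b<2^(m*l). x ^ wt (2^l) m a b * pauli_prob (m*l) (kraus_tpow Bs m) a b) =
    (\<Sum>a<2^l. \<Sum>b<2^l. (if a = 0 \<and> b = 0 then 1 else x) * pauli_prob l Bs a b) ^ m"
proof (induction m)
  case 0
  show ?case by (simp add: pauli_prob_def pauli_coeff_def)
next
  case (Suc m)
  let ?M = "2^(m*l) :: nat" and ?q = "2^l :: nat"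
  let ?f = "\<lambda>a b. x ^ wt ?q (Suc m) a b * pauli_prob (m*l+l) (kraus_tpow Bs (Suc m)) a b"
  let ?g = "\<lambda>a b. (if a = 0 \<and> b = 0 then 1 else x) * pauli_prob l Bs a b"
  let ?h = "\<lambda>a b. x ^ wt ?q m a b * pauli_prob (m*l) (kraus_tpow Bs m) a b"
  have e: "(2::nat)^(m*l+l) = ?q * ?M" by (simp add: power_add mult.commute)
  have "(\<Sum>a<2^(m*l+l). \<Sum>b<2^(m*l+l). ?f a b) = (\<Sum>a<?q. \<Sum>a'<?M. \<Sum>b<?q. \<Sum>b'<?M. ?f (a*?M+a') (b*?M+b'))"
    unfolding e sum_lessThan_mult ..
  also have "\<dots> = (\<Sum>a<?q. \<Sum>a'<?M. \<Sum>b<?q. \<Sum>b'<?M. ?g a b * ?h a' b')"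
  proof (intro sum.cong refl)
    fix a a' b b' assume l: "a \<in> {..<?q}" "a' \<in> {..<?M}" "b \<in> {..<?q}" "b' \<in> {..<?M}"
    then have "a*?M+a' < 2^(m*l+l)" unfolding e by (intro mult_add_less) auto
    from pauli_prob_tpow_Suc[OF B this, where b="b*?M+b'"]
    have "pauli_prob (m*l+l) (kraus_tpow Bs (Suc m)) (a*?M+a') (b*?M+b') = pauli_prob l Bs a b * pauli_prob (m*l) (kraus_tpow Bs m) a' b'"
      using l by simp
    moreover have "?q^m = ?M" by (simp add: power_mult[symmetric] mult.commute)
    then have "x ^ wt ?q (Suc m) (a*?M+a') (b*?M+b') = (if a = 0 \<and> b = 0 then 1 else x) * x ^ wt ?q m a' b'"
      using l by simp
    ultimately show "?f (a*?M+a') (b*?M+b') = ?g a b * ?h a' b'" by simp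
  qed
  also have "\<dots> = (\<Sum>a<?q. \<Sum>b<?q. \<Sum>a'<?M. \<Sum>b'<?M. ?g a b * ?h a' b')"
    by (rule sum.cong[OF refl], rule sum.swap)
  also have "\<dots> = (\<Sum>a<?q. \<Sum>b<?q. ?g a b) * (\<Sum>a'<?M. \<Sum>b'<?M. ?h a' b')"
    by (simp only: sum_distrib_left[symmetric] sum_distrib_right[symmetric])
  finally show ?case using Suc by (simp add: add.commute)
qed

section \<open>Concatenation\<close>

text \<open>Chernoff bound: the weight has generating function (F + x (1 - F))^m, and each error of
  weight above \<open>t\<close> enters it with a factor of at least x^(t+1). The parameter
  \<open>x\<close> stays free, to be matched to \<epsilon>.\<close>

lemma pauli_prob_low_weight:
  fixes x \<epsilon> :: real and m t :: nat
  assumes B: "is_channel (2^l) (2^l) Bs" and F: "1 - ent_fid_maxmixed (2^l) Bs \<le> \<epsilon>" and x: "x \<ge> 1"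
  defines "J \<equiv> {(a,b). a < 2^(m*l) \<and> b < 2^(m*l) \<and> wt (2^l) m a b \<le> t}"
  shows "1 - (\<Sum>(a,b)\<in>J. pauli_prob (m*l) (kraus_tpow Bs m) a b) \<le> (1 + x * \<epsilon>)^m / x^(t+1)"
proof -
  let ?M = "2^(m*l) :: nat" and ?q = "2^l :: nat"
  let ?P = "{..<?M} \<times> {..<?M}"
  define p where "p = (\<lambda>(a,b). pauli_prob (m*l) (kraus_tpow Bs m) a b)"
  define w where "w = (\<lambda>(a,b). wt ?q m a b)"
  define F where "F = pauli_prob l Bs 0 0"
  note Bc = is_channelD(1)[OF B]
  have gen: "(\<Sum>z\<in>?P. y ^ w z * p z) = (F + y * (1 - F))^m" for y :: real
  proof -
    have "(\<Sum>a<?q. \<Sum>b<?q. (if a = 0 \<and> b = 0 then 1 else y) * pauli_prob l Bs a b)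
      = (\<Sum>a<?q. \<Sum>b<?q. (if a = 0 then if b = 0 then (1 - y) * pauli_prob l Bs a b else 0 else 0) + y * pauli_prob l Bs a b)"
      by (intro sum.cong refl) (auto simp: algebra_simps)
    also have "\<dots> = (\<Sum>a<?q. \<Sum>b<?q. if a = 0 then if b = 0 then (1 - y) * pauli_prob l Bs a b else 0 else 0) + y * (\<Sum>a<?q. \<Sum>b<?q. pauli_prob l Bs a b)"
      by (simp add: sum.distrib sum_distrib_left)
    also have "(\<Sum>a<?q. \<Sum>b<?q. if a = 0 then if b = 0 then (1 - y) * pauli_prob l Bs a b else 0 else 0) = (\<Sum>a<?q. if a = 0 then (1 - y) * pauli_prob l Bs a 0 else 0)"
      by (intro sum.cong refl) (auto simp: sum.delta)
    also have "\<dots> = (1 - y) * F" by (simp add: sum.delta F_def)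
    also have "(1 - y) * F + y * (\<Sum>a<?q. \<Sum>b<?q. pauli_prob l Bs a b) = F + y * (1 - F)"
      by (simp add: sum_pauli_prob[OF B] algebra_simps)
    finally show ?thesis
      using wt_generating_function[OF Bc, where x=y and m=m] by (simp add: sum.cartesian_product p_def w_def case_prod_beta)
  qed
  have F1: "F \<le> 1"
    using sum_pauli_prob[OF B] member_le_sum[of 0 "{..<?q}" "\<lambda>a. \<Sum>b<?q. pauli_prob l Bs a b"]
      member_le_sum[of 0 "{..<?q}" "\<lambda>b. pauli_prob l Bs 0 b"]
    by (auto simp: F_def pauli_prob_nonneg sum_nonneg)
  have Feps: "1 - F \<le> \<epsilon>" using F Bc by (simp add: F_def pauli_prob_0)
  have p0: "p z \<ge> 0" for z by (auto simp: p_def pauli_prob_nonneg split: prod.split)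
  have J: "J \<subseteq> ?P" by (auto simp: J_def)
  \<comment> \<open>At y = 1 the generating function is the total mass.\<close>
  have "1 = sum p ?P" using gen[of 1] by simp
  also have "\<dots> = sum p J + sum p (?P - J)" by (subst sum.subset_diff[OF J]) auto
  finally have "1 - sum p J = sum p (?P - J)" by linarith
  then have "x^(t+1) * (1 - sum p J) = (\<Sum>z\<in>?P - J. x^(t+1) * p z)"
    by (simp only: sum_distrib_left)
  also have "\<dots> \<le> (\<Sum>z\<in>?P - J. x^w z * p z)"
    using x p0 by (intro sum_mono mult_right_mono power_increasing) (auto simp: J_def w_def)
  also have "\<dots> \<le> (\<Sum>z\<in>?P. x^w z * p z)"
    using x p0 by (intro sum_mono2) auto
  also have "\<dots> = (1 + (x - 1) * (1 - F))^m" unfolding gen by (simp add: algebra_simps)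
  also have "\<dots> \<le> (1 + x * \<epsilon>)^m"
    using x F1 Feps by (intro power_mono add_left_mono mult_mono) auto
  finally have "(1 - sum p J) * x^(t+1) \<le> (1 + x * \<epsilon>)^m" by (simp only: mult.commute)
  then have "1 - sum p J \<le> (1 + x * \<epsilon>)^m / x^(t+1)" using x by (subst pos_le_divide_eq) auto
  then show ?thesis by (simp add: p_def)
qed

text \<open>Fewer than 2^m (2^l)^(2 t) = 2^L nonzero strings have weight at most 2 t; this fixes L =
  m + 2 t l and the loss of 3 L outer qubits. Tensor powers of the inner encoder and decoder turn
  the channel into \<open>m\<close> copies of the effective one, on which the outer code
  acts.\<close>

lemma concatenated_code:
  fixes x \<epsilon> :: real
  assumes A: "is_channel dc dout As" and C: "is_code dc dout n (2^l) Es Ds"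
    and F: "1 - code_fid As n (2^l) Es Ds \<le> \<epsilon>" and x: "x \<ge> 1"
    and len: "3 * (m + 2*t*l) + 2 \<le> m*l"
  shows "\<exists>Es' Ds'. is_code dc dout (n*m) (2^(m*l - 3*(m + 2*t*l))) Es' Ds' \<and>
    1 - code_fid As (n*m) (2^(m*l - 3*(m + 2*t*l))) Es' Ds' \<le> (1 + x * \<epsilon>)^m / x^(t+1)"
proof -
  define N where "N = m*l"
  define L where "L = m + 2*t*l"
  define K :: nat where "K = 2^(N - 3*L)"
  define Bs where "Bs = kraus_comp3 Ds (kraus_tpow As n) Es"
  define Ts where "Ts = kraus_tpow Bs m"
  define J where "J = {(a,b). a < 2^(m*l) \<and> b < 2^(m*l) \<and> wt (2^l) m a b \<le> t}"
  \<comment> \<open>Differences of the bit parts, or of the phase parts, of two correctable errors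
    have weight at most 2 t. Leaving out 0 makes the count below strict.\<close>
  define \<Delta> where "\<Delta> = {a. 0 < a \<and> a < 2^N \<and> wt (2^l) m a 0 \<le> 2*t}"
  have qm: "((2::nat)^l)^m = 2^N" by (simp add: N_def power_mult[symmetric] mult.commute)
  have E: "is_channel (2^l) (dc^n) Es" and D: "is_channel (dout^n) (2^l) Ds" using C by (auto simp: is_code_def)
  have B: "is_channel (2^l) (2^l) Bs" unfolding Bs_def by (rule is_channel_code[OF A C])
  have T: "is_channel (2^N) (2^N) Ts" using is_channel_tpow[OF B, of m] by (simp add: Ts_def qm)
  have "card \<Delta> < card {a. a < (2^l)^m \<and> wt (2^l) m a 0 \<le> 2*t}" (is "_ < card ?S")
  proof (rule psubset_card_mono)
    have "0 \<in> ?S" "0 \<notin> \<Delta>" "\<Delta> \<subseteq> ?S" by (simp, simp add: \<Delta>_def, simp add: \<Delta>_def qm Collect_mono)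
    then show "\<Delta> \<subset> ?S" by blast
  qed simp
  also have "\<dots> \<le> 2^m * (2^l)^(2*t)" by (rule card_wt_le) simp
  also have "\<dots> = 2^L" by (simp add: L_def power_add power_mult[symmetric] mult_ac)
  finally have card: "card \<Delta> < 2^L" .
  have sub: "\<Delta> \<subseteq> {1..<2^N}" by (auto simp: \<Delta>_def)
  have len': "3*L+2 \<le> N" using len by (simp add: L_def N_def)
  obtain V :: "nat \<Rightarrow> nat \<Rightarrow> real" where V0: "\<forall>a b a' b' i j. a < 2^N \<longrightarrow> b < 2^N \<longrightarrow> a' < 2^N \<longrightarrow> b' < 2^N \<longrightarrow>
     xor a a' \<in> insert 0 \<Delta> \<longrightarrow> xor b b' \<in> insert 0 \<Delta> \<longrightarrow> i < K \<longrightarrow> j < K \<longrightarrow>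
     (\<Sum>y<2^N. (chi N b (xor y a) * V (xor y a) i) * (chi N b' (xor y a') * V (xor y a') j))
       = (if i = j \<and> a = a' \<and> b = b' then 1 else 0)"
    using css_code_exists[OF sub card len'] unfolding K_def[symmetric] by (elim exE) (rule that)
  note V = V0[rule_format]
  define W where "W = mat (2^N) K (\<lambda>(x,i). complex_of_real (V x i))"
  have W: "W \<in> carrier_mat (2^N) K" by (simp add: W_def)
  have PW: "(pauli N a b * W) $$ (y,i) = of_real (chi N b (xor y a) * V (xor y a) i)" if "y < 2^N" "a < 2^N" "i < K" for a b y i
    using pauli_mult_index[OF W that(1,2,3)] that by (simp add: W_def xor_less_exp)
  have orth: "(\<Sum>y<2^N. cnj ((pauli N a b * W) $$ (y,i)) * (pauli N a' b' * W) $$ (y,j)) = (if i = j \<and> (a,b) = (a',b') then 1 else 0)"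
    if "a < 2^N" "b < 2^N" "a' < 2^N" "b' < 2^N" "xor a a' \<in> insert 0 \<Delta>" "xor b b' \<in> insert 0 \<Delta>" "i < K" "j < K" for a b a' b' i j
  proof -
    have "(\<Sum>y<2^N. cnj ((pauli N a b * W) $$ (y,i)) * (pauli N a' b' * W) $$ (y,j)) =
      complex_of_real (\<Sum>y<2^N. (chi N b (xor y a) * V (xor y a) i) * (chi N b' (xor y a') * V (xor y a') j))"
      unfolding of_real_sum using that by (intro sum.cong refl) (simp add: PW)
    also have "\<dots> = complex_of_real (if i = j \<and> a = a' \<and> b = b' then 1 else 0)"
      by (simp only: V[OF that])
    finally show ?thesis by simp
  qed
  have Jlt: "J \<subseteq> {..<2^N} \<times> {..<2^N}" by (auto simp: J_def N_def)
  have JD: "xor a a' \<in> insert 0 \<Delta> \<and> xor b b' \<in> insert 0 \<Delta>" if "(a,b) \<in> J" "(a',b') \<in> J" for a b a' b'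
  proof -
    have "a < 2^N" "b < 2^N" "a' < 2^N" "b' < 2^N" using that Jlt by auto
    moreover have "wt (2^l) m (xor a a') 0 \<le> 2*t" "wt (2^l) m (xor b b') 0 \<le> 2*t"
      using that wt_xor_le[of l m a a'] wt_xor_le[of l m b b'] wt_le_joint(1)[of "2^l" m a b] wt_le_joint(2)[of "2^l" m b a]
        wt_le_joint(1)[of "2^l" m a' b'] wt_le_joint(2)[of "2^l" m b' a'] unfolding J_def by auto
    ultimately show ?thesis by (auto simp: \<Delta>_def xor_less_exp)
  qed
  have K1: "K \<ge> 1" by (simp add: K_def)
  have "\<exists>Eo Do. is_channel K (2^N) Eo \<and> is_channel (2^N) K Do \<and>
    (\<Sum>(a,b)\<in>J. \<Sum>T\<leftarrow>Ts. (cmod (pauli_coeff N a b T))\<^sup>2) \<le>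
    (\<Sum>D\<leftarrow>Do. \<Sum>T\<leftarrow>Ts. \<Sum>E\<leftarrow>Eo. (cmod (mtrace (D * T * E)))\<^sup>2) / (real K)\<^sup>2"
  proof (rule twirled_code[OF W K1 is_channelD(1)[OF T] Jlt])
    show "(\<Sum>y<2^N. cnj ((pauli N a b * W) $$ (y,i)) * (pauli N a b * W) $$ (y,j)) = (if i = j then 1 else 0)"
      if "a < 2^N" "b < 2^N" "i < K" "j < K" for a b i j
      using orth[OF that(1,2,1,2) _ _ that(3,4)] by simp
    show "(\<Sum>y<2^N. cnj ((pauli N a b * W) $$ (y,i)) * (pauli N a' b' * W) $$ (y,j)) = (if i = j \<and> (a,b) = (a',b') then 1 else 0)"
      if "(a,b) \<in> J" "(a',b') \<in> J" "i < K" "j < K" for a b a' b' i j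
      using that JD[OF that(1,2)] Jlt by (intro orth) auto
  qed
  then obtain Eo Do where Eo: "is_channel K (2^N) Eo" and Do: "is_channel (2^N) K Do" and
    fid: "(\<Sum>(a,b)\<in>J. pauli_prob N Ts a b) \<le>
    (\<Sum>D\<leftarrow>Do. \<Sum>T\<leftarrow>Ts. \<Sum>E\<leftarrow>Eo. (cmod (mtrace (D * T * E)))\<^sup>2) / (real K)\<^sup>2"
    unfolding pauli_prob_def by blast
  define Es' where "Es' = [X * E. X \<leftarrow> kraus_tpow Es m, E \<leftarrow> Eo]"
  define Ds' where "Ds' = [D * Y. D \<leftarrow> Do, Y \<leftarrow> kraus_tpow Ds m]"
  have Em: "is_channel (2^N) (dc^(n*m)) (kraus_tpow Es m)" and Dm: "is_channel (dout^(n*m)) (2^N) (kraus_tpow Ds m)"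
    using is_channel_tpow[OF E, of m] is_channel_tpow[OF D, of m] by (simp_all add: qm power_mult)
  note Am = is_channel_tpow[OF A, of "n*m"]
  have C': "is_code dc dout (n*m) K Es' Ds'"
    using is_channel_compose[OF Em Eo] is_channel_compose[OF Do Dm] K1 by (simp add: is_code_def Es'_def Ds'_def)
  have "(\<Sum>D\<leftarrow>Do. \<Sum>T\<leftarrow>Ts. \<Sum>E\<leftarrow>Eo. (cmod (mtrace (D * T * E)))\<^sup>2) =
    (\<Sum>D\<leftarrow>Do. \<Sum>Y\<leftarrow>kraus_tpow Ds m. \<Sum>A\<leftarrow>kraus_tpow As (n*m). \<Sum>X\<leftarrow>kraus_tpow Es m. \<Sum>E\<leftarrow>Eo. (cmod (mtrace (D * (Y * A * X) * E)))\<^sup>2)"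
    unfolding Ts_def Bs_def
    by (subst sum_tpow_comp3[OF is_channelD(1)[OF D] is_channelD(1)[OF is_channel_tpow[OF A]] is_channelD(1)[OF E]])
       (simp_all add: kraus_tpow_mult)
  also have "\<dots> = (\<Sum>D\<leftarrow>Do. \<Sum>Y\<leftarrow>kraus_tpow Ds m. \<Sum>A\<leftarrow>kraus_tpow As (n*m). \<Sum>X\<leftarrow>kraus_tpow Es m. \<Sum>E\<leftarrow>Eo. (cmod (mtrace (D * Y * A * (X * E))))\<^sup>2)"
  proof (intro arg_cong[where f=sum_list] map_cong refl)
    fix U Y Z X G assume "U \<in> set Do" "Y \<in> set (kraus_tpow Ds m)" "Z \<in> set (kraus_tpow As (n*m))" "X \<in> set (kraus_tpow Es m)" "G \<in> set Eo"
    note c = is_channelD(1)[OF Do this(1)] is_channelD(1)[OF Dm this(2)] is_channelD(1)[OF Am this(3)] is_channelD(1)[OF Em this(4)] is_channelD(1)[OF Eo this(5)]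
    have "U * (Y * Z * X) * G = U * Y * Z * X * G"
      by (simp only: assoc_mult_mat[OF c(1) mult_carrier_mat[OF c(2,3)] c(4)] assoc_mult_mat[OF c(1,2,3)])
    also have "\<dots> = U * Y * Z * (X * G)"
      by (rule assoc_mult_mat[OF mult_carrier_mat[OF mult_carrier_mat[OF c(1,2)] c(3)] c(4,5)])
    finally show "(cmod (mtrace (U * (Y * Z * X) * G)))\<^sup>2 = (cmod (mtrace (U * Y * Z * (X * G))))\<^sup>2" by simp
  qed
  also have "\<dots> = (\<Sum>B\<leftarrow>kraus_comp3 Ds' (kraus_tpow As (n*m)) Es'. (cmod (mtrace B))\<^sup>2)"
    by (simp add: sum_comp3 Ds'_def Es'_def sum_list_concat_map o_def)
  finally have "(\<Sum>(a,b)\<in>J. pauli_prob N Ts a b) \<le> code_fid As (n*m) K Es' Ds'"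
    using fid by (simp add: code_fid_eq[OF A C'])
  moreover have "1 - (\<Sum>(a,b)\<in>J. pauli_prob N Ts a b) \<le> (1 + x * \<epsilon>)^m / x^(t+1)"
    unfolding J_def N_def Ts_def
    by (rule pauli_prob_low_weight[OF B _ x]) (use F in \<open>simp add: code_fid_def Bs_def\<close>)
  ultimately have "1 - code_fid As (n*m) K Es' Ds' \<le> (1 + x * \<epsilon>)^m / x^(t+1)" by linarith
  then show ?thesis using C' unfolding K_def N_def L_def by blast
qed

section \<open>Attainable exponents\<close>

text \<open>The sequence must contain a code at every length, so below \<open>n0\<close> some code
  is still demanded, of whatever quality; the limits only see the lengths from \<open>n0\<close>
  on.\<close>

lemma attainable_exponentI:
  assumes "\<And>n. \<exists>k Es Ds. is_code dc dout n k Es Ds \<and>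
      (n \<ge> n0 \<longrightarrow> R \<le> log (real d) (real k) / real n \<and> ereal E \<le> err_exp_term d n (code_fid As n k Es Ds))"
  shows "attainable_exponent d dc dout As R E"
proof -
  obtain k Es Ds where c: "\<And>n. is_code dc dout n (k n) (Es n) (Ds n) \<and>
      (n \<ge> n0 \<longrightarrow> R \<le> log (real d) (real (k n)) / real n \<and> ereal E \<le> err_exp_term d n (code_fid As n (k n) (Es n) (Ds n)))"
    using assms by metis
  have ev: "eventually (\<lambda>n. n \<ge> n0) sequentially" by (rule eventually_ge_at_top)
  have "liminf (\<lambda>n. ereal (log (real d) (real (k n)) / real n)) \<ge> ereal R"
    by (rule Liminf_bounded) (use ev in \<open>rule eventually_mono\<close>, use c in auto)
  moreover have "liminf (\<lambda>n. err_exp_term d n (code_fid As n (k n) (Es n) (Ds n))) \<ge> ereal E"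
    by (rule Liminf_bounded) (use ev in \<open>rule eventually_mono\<close>, use c in auto)
  ultimately show ?thesis unfolding attainable_exponent_def using c by blast
qed

text \<open>The one-dimensional code has rate 0 and infidelity 0, where the exponent term is
  infinite by convention; 1 is an arbitrary positive value.\<close>

lemma attainable_exponent_nonpos_rate:
  assumes A: "is_channel dc dout As" and dc: "dc \<ge> 1" and R: "R \<le> 0"
  shows "attainable_exponent d dc dout As R 1"
proof (rule attainable_exponentI[of _ _ 0])
  fix n
  obtain Es Ds where "is_code dc dout n 1 Es Ds" "code_fid As n 1 Es Ds = 1" using trivial_code[OF A dc] by blast
  then show "\<exists>k Es Ds. is_code dc dout n k Es Ds \<and>
      (0 \<le> n \<longrightarrow> R \<le> log (real d) (real k) / real n \<and> ereal 1 \<le> err_exp_term d n (code_fid As n k Es Ds))"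
    using R by (intro exI[of _ 1] exI[of _ Es] exI[of _ Ds]) (simp add: err_exp_term_def)
qed

text \<open>The limsup yields the rate only infinitely often, but the fidelity is close to 1
  eventually, so both hold together at arbitrarily large lengths.\<close>

lemma achievable_rate_inner_code:
  assumes "achievable_rate d dc dout As R'" "R < R'" "\<epsilon> > 0"
  shows "\<exists>n\<ge>n0. \<exists>k Es Ds. is_code dc dout n k Es Ds \<and> R < log (real d) (real k) / real n \<and> 1 - code_fid As n k Es Ds < \<epsilon>"
proof -
  obtain k Es Ds where c: "\<And>n. is_code dc dout n (k n) (Es n) (Ds n)"
    and sup: "limsup (\<lambda>n. ereal (log (real d) (real (k n)) / real n)) \<ge> ereal R'"
    and lim: "(\<lambda>n. code_fid As n (k n) (Es n) (Ds n)) \<longlonglongrightarrow> 1"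
    using assms(1) unfolding achievable_rate_def by blast
  have "ereal R < limsup (\<lambda>n. ereal (log (real d) (real (k n)) / real n))"
    using assms(2) sup by (meson ereal_less_eq(3) less_le_trans less_ereal.simps(1))
  then have fr: "\<exists>\<^sub>F n in sequentially. R < log (real d) (real (k n)) / real n"
    unfolding frequently_def by (metis (mono_tags, lifting) Limsup_bounded eventually_mono ereal_less_eq(3) not_le)
  have "eventually (\<lambda>n. 1 - \<epsilon> < code_fid As n (k n) (Es n) (Ds n)) sequentially"
    using lim assms(3) by (intro order_tendstoD(1)) auto
  then have "eventually (\<lambda>n. 1 - \<epsilon> < code_fid As n (k n) (Es n) (Ds n) \<and> n \<ge> n0) sequentially"
    using eventually_ge_at_top[of n0] by eventually_elim simp
  from frequently_ex[OF frequently_eventually_conj[OF fr this]]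
  obtain n where "1 - \<epsilon> < code_fid As n (k n) (Es n) (Ds n)" "n \<ge> n0" "R < log (real d) (real (k n)) / real n" by auto
  moreover from this have "1 - code_fid As n (k n) (Es n) (Ds n) < \<epsilon>" by simp
  ultimately show ?thesis using c[of n] by blast
qed

text \<open>The inner code is chosen only after the fraction \<open>1/s\<close> of correctable blocks is fixed: a large
  inner block length makes both the inner infidelity and the relative overhead \<open>3/l\<close> of the outer code small.\<close>

lemma inner_code_exists:
  assumes A: "is_channel dc dout As" and d: "d \<ge> 2" and ach: "achievable_rate d dc dout As R'"
    and R: "0 \<le> R" "R < R'"
  shows "\<exists>s n l Es Ds. s > 0 \<and> n > 0 \<and> is_code dc dout n (2^l) Es Ds \<and>
    1 - code_fid As n (2^l) Es Ds \<le> (1 / (2 * real d))^s \<and>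
    R * real n < (real l * (1 - 6 / real s) - 3) * log d 2"
proof -
  define \<kappa> where "\<kappa> = log (real d) 2"
  have \<kappa>: "\<kappa> > 0" using d by (simp add: \<kappa>_def)
  \<comment> \<open>A midpoint: a limsup of at least \<open>R'\<close> only guarantees rates above
    values strictly below \<open>R'\<close>.\<close>
  define R'' where "R'' = (R + R') / 2"
  have R'': "R < R''" "R'' < R'" "R'' > 0" using R by (auto simp: R''_def)
  \<comment> \<open>The overhead 3 L contains 6 t l with t \<le> m/s, a share 6/s of the inner
    qubits. This \<open>s\<close> keeps (1 - 6/s) R'' above R.\<close>
  obtain s :: nat where s: "real s > max 6 (6 * R'' / (R'' - R))" using reals_Archimedean2 by blast
  then have s6: "real s > 6" and "6 * R'' / (R'' - R) < real s" by auto
  then have gap: "(1 - 6 / real s) * R'' - R > 0" using R'' by (simp add: field_simps)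
  \<comment> \<open>Of the 4, three cover the summand 3 m of 3 L and at most one covers rounding the
    inner dimension down to a power of 2.\<close>
  obtain n0 :: nat where n0: "real n0 > 4 * \<kappa> / ((1 - 6 / real s) * R'' - R)" using reals_Archimedean2 by blast
  \<comment> \<open>The additional factor 1/2 pays for the restriction to dimension 2^l, which at
    most doubles the infidelity.\<close>
  define \<epsilon> where "\<epsilon> = (1 / (2 * real d))^s / 2"
  have "\<epsilon> > 0" using d by (simp add: \<epsilon>_def)
  from achievable_rate_inner_code[OF ach R''(2) this, of "Suc n0"]
  obtain n k Es Ds where n: "n \<ge> Suc n0" and C: "is_code dc dout n k Es Ds" and
    rate: "R'' < log (real d) (real k) / real n" and F: "1 - code_fid As n k Es Ds < \<epsilon>" by blast
  have k: "k \<ge> 1" using C by (simp add: is_code_def)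
  then obtain l where l: "2^l \<le> k" "k < 2^(Suc l)"
    using ex_power_ivl1[of 2 k] by auto
  obtain Es' Ds' where C': "is_code dc dout n (2^l) Es' Ds'" and
    F': "real (2^l) * (1 - code_fid As n (2^l) Es' Ds') \<le> real k * (1 - code_fid As n k Es Ds)"
    using code_restrict[OF A C _ l(1)] by auto
  have "real k * (1 - code_fid As n k Es Ds) \<le> real k * \<epsilon>" using F by (intro mult_left_mono) auto
  also have "\<dots> \<le> (2 * 2^l) * \<epsilon>" using l(2) \<open>\<epsilon> > 0\<close> of_nat_less_iff[of k "2^Suc l", where 'a=real] by (intro mult_right_mono) auto
  finally have "2^l * (1 - code_fid As n (2^l) Es' Ds') \<le> (2 * 2^l) * \<epsilon>"
    using order_trans[OF F'] by (simp only: of_nat_power of_nat_numeral)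
  then have fid: "1 - code_fid As n (2^l) Es' Ds' \<le> (1 / (2 * real d))^s"
    by (simp add: \<epsilon>_def)
  have "log (real d) (real k) \<le> log (real d) (2^Suc l)"
    using d k l(2) of_nat_less_iff[of k "2^Suc l", where 'a=real] by (subst log_le_cancel_iff) auto
  also have "\<dots> = (real l + 1) * \<kappa>" using d by (simp add: \<kappa>_def log_nat_power algebra_simps log_mult)
  finally have "R'' * real n < (real l + 1) * \<kappa>" using rate n by (simp add: field_simps)
  then have "(1 - 6 / real s) * (R'' * real n) < (1 - 6 / real s) * ((real l + 1) * \<kappa>)"
    using s6 by (intro mult_strict_left_mono) auto
  moreover have "4 * \<kappa> < ((1 - 6 / real s) * R'' - R) * real n"
  proof -
    have "4 * \<kappa> < real n0 * ((1 - 6 / real s) * R'' - R)" using n0 gap by (simp add: pos_divide_less_eq)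
    also have "\<dots> \<le> real n * ((1 - 6 / real s) * R'' - R)" using n gap by (intro mult_right_mono) auto
    finally show ?thesis by (simp add: mult.commute)
  qed
  moreover have "(1 - 6 / real s) * \<kappa> \<le> 1 * \<kappa>" using s6 \<kappa> by (intro mult_right_mono) auto
  ultimately have "R * real n < (real l * (1 - 6 / real s) - 3) * \<kappa>" by (simp add: algebra_simps add_divide_distrib)
  then show ?thesis using C' fid s6 n unfolding \<kappa>_def by (intro exI[of _ s] exI[of _ n] exI[of _ l]) auto
qed

text \<open>With x = (2 d)^s and \<epsilon> = (2 d)^(-s), x \<epsilon> = 1 and the tail bound has
  numerator 2^m; as s (t + 1) \<ge> m, its denominator is at least (2 d)^m, so d^(-m) remains. The 2
  in 2 d cancels the numerator; the 2 in the exponent 1/(2 n) absorbs the padding.\<close>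

lemma attainable_exponent_from_inner_code:
  assumes A: "is_channel dc dout As" and dc: "dc \<ge> 1" and d: "d \<ge> 2" and R: "R \<ge> 0"
    and s: "s > 0" and n: "n > 0" and C: "is_code dc dout n (2^l) Es Ds"
    and F: "1 - code_fid As n (2^l) Es Ds \<le> (1 / (2 * real d))^s"
    and rate: "R * real n < (real l * (1 - 6 / real s) - 3) * log d 2"
  shows "attainable_exponent d dc dout As R (1 / (2 * real n))"
proof -
  define \<kappa> where "\<kappa> = log (real d) 2"
  have \<kappa>: "\<kappa> > 0" using d by (simp add: \<kappa>_def)
  \<comment> \<open>A lower bound for the net qubits per inner block: the outer code keeps at least
    m r of its m l qubits.\<close>
  define r where "r = real l * (1 - 6 / real s) - 3"
  have rate': "R * real n < r * \<kappa>" using rate by (simp add: r_def \<kappa>_def)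
  have "0 \<le> R * real n" using R by simp
  then have r: "r > 0" using rate' \<kappa> by (metis less_le_trans not_less order.strict_trans1 zero_less_mult_pos2)
  \<comment> \<open>In turn: m r > 2 for the length condition of the outer code, R n (m + 1) \<le> m
    r \<kappa> to absorb an incomplete last block in the rate, and m > 1 to absorb it in the
    exponent.\<close>
  obtain m0 :: nat where m0: "real m0 > max (2 / r) (max (R * real n / (r * \<kappa> - R * real n)) 1)" using reals_Archimedean2 by blast
  show ?thesis
  proof (rule attainable_exponentI[of _ _ "n * m0"])
    fix n'
    show "\<exists>k Es Ds. is_code dc dout n' k Es Ds \<and> (n * m0 \<le> n' \<longrightarrow> R \<le> log (real d) (real k) / real n' \<and>
      ereal (1 / (2 * real n)) \<le> err_exp_term d n' (code_fid As n' k Es Ds))"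
    proof (cases "n * m0 \<le> n'")
      case False
      then show ?thesis using trivial_code[OF A dc, of n'] by blast
    next
      case True
      define m where "m = n' div n"
      define t where "t = m div s"
      have "m0 \<le> m" using True n by (simp add: m_def less_eq_div_iff_mult_less_eq mult.commute)
      then have m: "real m > 2 / r" "real m > R * real n / (r * \<kappa> - R * real n)" "real m > 1" using m0 by auto
      have nm: "n * m \<le> n'" by (simp add: m_def)
      have "n' < n * (m + 1)" using n unfolding m_def by (metis Suc_eq_plus1 dividend_less_times_div mult.commute mult_Suc_right)
      then have n'less: "real n' < real n * (real m + 1)" using of_nat_less_iff[of n' "n * (m+1)", where 'a=real] by (simp add: algebra_simps)
      have n'pos: "real n' > 0" using True n m0 by (cases n') auto
      have t1: "real t * real s \<le> real m" unfolding of_nat_mult[symmetric] of_nat_le_iff t_def by simp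
      have t2: "m \<le> s * (t + 1)" using s unfolding t_def by (metis Suc_eq_plus1 dividend_less_times_div less_imp_le_nat mult_Suc_right)
      have "real (3 * (m + 2*t*l) + 2) + (real m * r - 2) \<le> real (m*l)"
      proof -
        have "real t \<le> real m / real s" using t1 s by (simp add: field_simps)
        then have "6 * real l * real t \<le> 6 * real l * (real m / real s)" by (intro mult_left_mono) auto
        then show ?thesis by (simp add: r_def algebra_simps)
      qed
      note lenr = this
      have "real m * r > 2" using m(1) r by (simp add: field_simps)
      then have len: "3 * (m + 2*t*l) + 2 \<le> m*l" using lenr by linarith
      define K :: nat where "K = 2^(m*l - 3*(m + 2*t*l))"
      have x: "(2 * real d)^s \<ge> 1" using d by (intro one_le_power) auto
      obtain Es1 Ds1 where C1: "is_code dc dout (n*m) K Es1 Ds1" and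
        F1: "1 - code_fid As (n*m) K Es1 Ds1 \<le> (1 + (2 * real d)^s * (1 / (2 * real d))^s)^m / ((2 * real d)^s)^(t+1)"
        using concatenated_code[OF A C F x len] unfolding K_def by blast
      obtain Es2 Ds2 where C2: "is_code dc dout n' K Es2 Ds2" and
        F2: "code_fid As n' K Es2 Ds2 = code_fid As (n*m) K Es1 Ds1"
        using code_pad[OF A dc C1 nm] by blast
      have "(1 + (2 * real d)^s * (1 / (2 * real d))^s)^m / ((2 * real d)^s)^(t+1) = 2^m / (2 * real d)^(s*(t+1))"
      proof -
        have "(2 * real d)^s * (1 / (2 * real d))^s = 1" using d by (simp add: power_one_over)
        then show ?thesis unfolding power_mult by simp
      qed
      also have "\<dots> \<le> 2^m / (2 * real d)^m"
        using d t2 by (intro divide_left_mono power_increasing mult_pos_pos zero_less_power) auto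
      also have "\<dots> = 1 / real d ^ m" using d by (simp add: power_mult_distrib)
      finally have err: "1 - code_fid As n' K Es2 Ds2 \<le> 1 / real d ^ m" using F1 F2 by simp
      have "ereal (1 / (2 * real n)) \<le> err_exp_term d n' (code_fid As n' K Es2 Ds2)"
      proof (cases "1 - code_fid As n' K Es2 Ds2 \<le> 0")
        case False
        then have "log d (1 - code_fid As n' K Es2 Ds2) \<le> log d (1 / real d ^ m)"
          using err d by (subst log_le_cancel_iff) auto
        also have "\<dots> = - real m" using d by (simp add: log_divide log_nat_power)
        finally have "real m \<le> - log d (1 - code_fid As n' K Es2 Ds2)" by simp
        then have "real m / real n' \<le> - log d (1 - code_fid As n' K Es2 Ds2) / real n'"
          using n'pos by (intro divide_right_mono) auto
        moreover have "1 / (2 * real n) \<le> real m / real n'"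
        proof -
          have "real n * (real m + 1) \<le> real n * (2 * real m)" using m(3) by (intro mult_left_mono) auto
          then have "real n' \<le> 2 * real n * real m" using n'less by (simp add: mult_ac)
          then show ?thesis using n n'pos by (simp add: field_simps)
        qed
        ultimately show ?thesis using False by (simp add: err_exp_term_def)
      qed (simp add: err_exp_term_def)
      moreover have "R \<le> log (real d) (real K) / real n'"
      proof -
        have "log (real d) (real K) = real (m*l - 3*(m + 2*t*l)) * \<kappa>"
          using d by (simp add: K_def \<kappa>_def log_nat_power)
        also have "\<dots> \<ge> (real m * r) * \<kappa>"
          using lenr len \<kappa> by (intro mult_right_mono) (auto simp: of_nat_diff)
        finally have 1: "real m * r * \<kappa> \<le> log (real d) (real K)" .
        have "R * real n < real m * (r * \<kappa> - R * real n)" using m(2) rate' by (simp add: pos_divide_less_eq)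
        then have "R * (real n * (real m + 1)) \<le> real m * r * \<kappa>" by (simp add: algebra_simps)
        moreover have "R * real n' \<le> R * (real n * (real m + 1))" using n'less R by (intro mult_left_mono) auto
        ultimately have "R * real n' \<le> log (real d) (real K)" using 1 by linarith
        then show ?thesis using n'pos by (simp add: field_simps)
      qed
      ultimately show ?thesis using C2 by blast
    qed
  qed
qed

theorem theorem2:
  fixes d dc dout :: nat and As :: "complex mat list" and R :: real
  assumes "prime d"
    and "dc \<ge> 1" and "dout \<ge> 1"
    and "is_channel dc dout As"
    and "ereal R < quantum_capacity d dc dout As"
  shows "\<exists>E>0. attainable_exponent d dc dout As R E"
proof (cases "R \<le> 0")
  case True
  then show ?thesis using attainable_exponent_nonpos_rate[OF assms(4,2)] by (intro exI[of _ 1]) simp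
next
  case False
  obtain R' where R': "achievable_rate d dc dout As R'" "R < R'"
    using assms(5) unfolding quantum_capacity_def less_Sup_iff by auto
  have d: "d \<ge> 2" using assms(1) by (rule prime_ge_2_nat)
  obtain s n l Es Ds where "s > 0" and n: "n > 0" and "is_code dc dout n (2^l) Es Ds"
    "1 - code_fid As n (2^l) Es Ds \<le> (1 / (2 * real d))^s"
    "R * real n < (real l * (1 - 6 / real s) - 3) * log d 2"
    using inner_code_exists[OF assms(4) d R'(1) _ R'(2)] False by auto
  then have "attainable_exponent d dc dout As R (1 / (2 * real n))"
    using False by (intro attainable_exponent_from_inner_code[OF assms(4,2) d]) auto
  then show ?thesis using n by (intro exI[of _ "1 / (2 * real n)"]) simp
qed

end
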